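(* Let $X$ be a smooth cell complex given by a $\delta$-sequence $Z\colon\delta\to\mathbf{Diff}$, where $\delta$ is a countable ordinal. Then for every $D$-open cover $\mathcal U=\{U_\lambda\}_{\lambda\in\Lambda}$ of $X$ there exists a partition of unity $\{\psi_\lambda\colon X\to\mathbf{R}\mid\lambda\in\Lambda\}$ by smooth functions subordinate to $\mathcal U$.
   Context: $\mathbf{Diff}$ denotes the category of diffeological spaces and smooth maps. For a diffeological space $X$, its $D$-topology is the finest topology on the underlying set making all plots continuous; "$D$-open" refers to it. $I^n$ is the $n$-cube and $\partial I^n$ its boundary, with the subspace diffeology from $\mathbf{R}^n$ (standard diffeology). A $\delta$-sequence ($\delta$ an ordinal) is a functor $Z\colon\delta\to\mathbf{Diff}$ such that for every limit ordinal $\beta<\delta$ the induced map $\operatorname{colim}_{\alpha<\beta}Z_\alpha\to Z_\beta$ is an isomorphism. A diffeological space $X$ is a smooth cell complex given by $Z$ if $Z_0=\emptyset$, $X=\operatorname{colim}Z$, and for each $\beta$ with $\beta+1<\delta$ there is $n_{\beta+1}\ge0$ and a pushout square in $\mathbf{Diff}$ exhibiting $Z_{\beta+1}=Z_\beta\cup_{\phi_{\beta+1}}I^{n_{\beta+1}}$ for a smooth attaching map $\phi_{\beta+1}\colon\partial I^{n_{\beta+1}}\to Z_\beta$. For a smooth $\psi\colon X\to\mathbf{R}$, $\operatorname{supp}\psi$ is the $D$-closure of $\{x\mid\psi(x)\ne0\}$. A collection of subsets of $X$ is locally finite if each point has a $D$-open neighbourhood meeting only finitely many members. A family of smooth maps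 $\{\psi_\lambda\colon X\to\mathbf{R}\}_{\lambda\in\Lambda}$ is a partition of unity subordinate to a $D$-open cover $\{U_\lambda\}_{\lambda\in\Lambda}$ if: $0\le\psi_\lambda\le1$ for all $\lambda$; $\operatorname{supp}\psi_\lambda\subset U_\lambda$ for all $\lambda$; $\{\operatorname{supp}\psi_\lambda\}_\lambda$ is locally finite; and $\sum_\lambda\psi_\lambda(x)=1$ for all $x\in X$. *)

theory Defs
  imports "HOL-Analysis.Analysis"
begin

section \<open>Euclidean spaces R^n, encoded inside nat => real\<close>

text \<open>R^n is encoded as the set of functions nat => real vanishing at all indices >= n,
  with the (product = Euclidean) topology.\<close>

definition Rn :: "nat \<Rightarrow> (nat \<Rightarrow> real) set" where
  "Rn n = {x. \<forall>i\<ge>n. x i = 0}"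

definition open_Rn :: "nat \<Rightarrow> (nat \<Rightarrow> real) set \<Rightarrow> bool" where
  "open_Rn n U \<longleftrightarrow> openin (top_of_set (Rn n)) U"

text \<open>C-infinity real functions on an open subset U of R^n: all iterated partial derivatives
  exist on U and are continuous on U (D is a family of functions closed under partial derivatives).\<close>

definition smooth_fun :: "nat \<Rightarrow> (nat \<Rightarrow> real) set \<Rightarrow> ((nat \<Rightarrow> real) \<Rightarrow> real) \<Rightarrow> bool" where
  "smooth_fun n U f \<longleftrightarrow>
     (\<exists>D. f \<in> D \<and>
        (\<forall>g\<in>D. continuous_on U g \<and>
           (\<forall>i<n. \<exists>g'\<in>D. \<forall>x\<in>U.
              ((\<lambda>t. g (x(i := x i + t))) has_real_derivative g' x) (at 0))))"

definition smooth_map :: "nat \<Rightarrow> (nat \<Rightarrow> real) set \<Rightarrow> nat \<Rightarrow> ((nat \<Rightarrow> real) \<Rightarrow> (nat \<Rightarrow> real)) \<Rightarrow> bool" where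
  "smooth_map m V n F \<longleftrightarrow> (\<forall>x\<in>V. F x \<in> Rn n) \<and> (\<forall>i<n. smooth_fun m V (\<lambda>x. F x i))"

section \<open>Diffeological spaces\<close>

text \<open>A diffeological space: a carrier and a predicate on parametrizations (n, U, p)
  where U is an open subset of R^n and p : U -> carrier.\<close>

record 'a diffsp =
  dcarrier :: "'a set"
  dplots :: "nat \<Rightarrow> (nat \<Rightarrow> real) set \<Rightarrow> ((nat \<Rightarrow> real) \<Rightarrow> 'a) \<Rightarrow> bool"

definition diffeology :: "'a diffsp \<Rightarrow> bool" where
  "diffeology X \<longleftrightarrow>
     (\<forall>n U p. dplots X n U p \<longrightarrow> open_Rn n U \<and> p ` U \<subseteq> dcarrier X) \<and>
     (\<forall>n U p q. dplots X n U p \<and> (\<forall>r\<in>U. p r = q r) \<longrightarrow> dplots X n U q) \<and>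
     (\<forall>n U x. open_Rn n U \<and> x \<in> dcarrier X \<longrightarrow> dplots X n U (\<lambda>_. x)) \<and>
     (\<forall>n U p. open_Rn n U \<and> p ` U \<subseteq> dcarrier X \<and>
        (\<forall>r\<in>U. \<exists>V. open_Rn n V \<and> r \<in> V \<and> V \<subseteq> U \<and> dplots X n V p)
        \<longrightarrow> dplots X n U p) \<and>
     (\<forall>n U p m V F. dplots X n U p \<and> open_Rn m V \<and> smooth_map m V n F \<and> F ` V \<subseteq> U
        \<longrightarrow> dplots X m V (p \<circ> F))"

definition dsmooth :: "'a diffsp \<Rightarrow> 'b diffsp \<Rightarrow> ('a \<Rightarrow> 'b) \<Rightarrow> bool" where
  "dsmooth X Y f \<longleftrightarrow> f ` dcarrier X \<subseteq> dcarrier Y \<and>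
     (\<forall>n U p. dplots X n U p \<longrightarrow> dplots Y n U (f \<circ> p))"

text \<open>Smooth maps X -> R (R with its standard diffeology).\<close>
definition dsmooth_real :: "'a diffsp \<Rightarrow> ('a \<Rightarrow> real) \<Rightarrow> bool" where
  "dsmooth_real X \<psi> \<longleftrightarrow> (\<forall>n U p. dplots X n U p \<longrightarrow> smooth_fun n U (\<psi> \<circ> p))"

definition Rn_diff :: "nat \<Rightarrow> (nat \<Rightarrow> real) diffsp" where
  "Rn_diff n = \<lparr>dcarrier = Rn n, dplots = (\<lambda>m U p. open_Rn m U \<and> smooth_map m U n p)\<rparr>"

definition subspace :: "'a diffsp \<Rightarrow> 'a set \<Rightarrow> 'a diffsp" where
  "subspace X A = \<lparr>dcarrier = A, dplots = (\<lambda>n U p. dplots X n U p \<and> p ` U \<subseteq> A)\<rparr>"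

definition cube :: "nat \<Rightarrow> (nat \<Rightarrow> real) set" where
  "cube n = {x \<in> Rn n. \<forall>i<n. 0 \<le> x i \<and> x i \<le> 1}"

definition cube_bdry :: "nat \<Rightarrow> (nat \<Rightarrow> real) set" where
  "cube_bdry n = {x \<in> cube n. \<exists>i<n. x i = 0 \<or> x i = 1}"

definition Icube :: "nat \<Rightarrow> (nat \<Rightarrow> real) diffsp" where
  "Icube n = subspace (Rn_diff n) (cube n)"

definition dIcube :: "nat \<Rightarrow> (nat \<Rightarrow> real) diffsp" where
  "dIcube n = subspace (Rn_diff n) (cube_bdry n)"

section \<open>D-topology, supports, partitions of unity\<close>

definition D_open :: "'a diffsp \<Rightarrow> 'a set \<Rightarrow> bool" where
  "D_open X A \<longleftrightarrow> A \<subseteq> dcarrier X \<and>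
     (\<forall>n U p. dplots X n U p \<longrightarrow> open_Rn n {r \<in> U. p r \<in> A})"

definition D_closure :: "'a diffsp \<Rightarrow> 'a set \<Rightarrow> 'a set" where
  "D_closure X S = \<Inter>{C. C \<subseteq> dcarrier X \<and> D_open X (dcarrier X - C) \<and> S \<subseteq> C}"

definition dsupp :: "'a diffsp \<Rightarrow> ('a \<Rightarrow> real) \<Rightarrow> 'a set" where
  "dsupp X \<psi> = D_closure X {x \<in> dcarrier X. \<psi> x \<noteq> 0}"

definition D_locally_finite :: "'a diffsp \<Rightarrow> 'l set \<Rightarrow> ('l \<Rightarrow> 'a set) \<Rightarrow> bool" where
  "D_locally_finite X L S \<longleftrightarrow>
     (\<forall>x\<in>dcarrier X. \<exists>W. D_open X W \<and> x \<in> W \<and> finite {l \<in> L. S l \<inter> W \<noteq> {}})"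

definition D_open_cover :: "'a diffsp \<Rightarrow> 'l set \<Rightarrow> ('l \<Rightarrow> 'a set) \<Rightarrow> bool" where
  "D_open_cover X L U \<longleftrightarrow> (\<forall>l\<in>L. D_open X (U l)) \<and> (\<Union>l\<in>L. U l) = dcarrier X"

definition partition_of_unity :: "'a diffsp \<Rightarrow> 'l set \<Rightarrow> ('l \<Rightarrow> 'a set) \<Rightarrow> ('l \<Rightarrow> 'a \<Rightarrow> real) \<Rightarrow> bool" where
  "partition_of_unity X L U \<psi> \<longleftrightarrow>
     (\<forall>l\<in>L. dsmooth_real X (\<psi> l)) \<and>
     (\<forall>l\<in>L. \<forall>x\<in>dcarrier X. 0 \<le> \<psi> l x \<and> \<psi> l x \<le> 1) \<and>
     (\<forall>l\<in>L. dsupp X (\<psi> l) \<subseteq> U l) \<and>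
     D_locally_finite X L (\<lambda>l. dsupp X (\<psi> l)) \<and>
     (\<forall>x\<in>dcarrier X. (\<Sum>l\<in>{l \<in> L. \<psi> l x \<noteq> 0}. \<psi> l x) = 1)"

section \<open>Colimits and pushouts in Diff (set-level colimit with the final diffeology)\<close>

text \<open>(Y, g) is a colimit in Diff of the diagram (Z a, Zm a b) indexed by the chain A.\<close>
definition diff_colimit :: "'i::order set \<Rightarrow> ('i \<Rightarrow> 'a diffsp) \<Rightarrow> ('i \<Rightarrow> 'i \<Rightarrow> 'a \<Rightarrow> 'a)
    \<Rightarrow> 'b diffsp \<Rightarrow> ('i \<Rightarrow> 'a \<Rightarrow> 'b) \<Rightarrow> bool" where
  "diff_colimit A Z Zm Y g \<longleftrightarrow>
     diffeology Y \<and>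
     (\<forall>a\<in>A. dsmooth (Z a) Y (g a)) \<and>
     (\<forall>a\<in>A. \<forall>c\<in>A. a \<le> c \<longrightarrow> (\<forall>x\<in>dcarrier (Z a). g c (Zm a c x) = g a x)) \<and>
     dcarrier Y = (\<Union>a\<in>A. g a ` dcarrier (Z a)) \<and>
     (let R = {((a, x), (c, Zm a c x)) | a c x. a \<in> A \<and> c \<in> A \<and> a \<le> c \<and> x \<in> dcarrier (Z a)}
      in \<forall>a\<in>A. \<forall>b\<in>A. \<forall>x\<in>dcarrier (Z a). \<forall>y\<in>dcarrier (Z b).
           g a x = g b y \<longleftrightarrow> ((a, x), (b, y)) \<in> (R \<union> R\<inverse>)\<^sup>*) \<and>
     (\<forall>n U p. dplots Y n U p \<longleftrightarrow>
        open_Rn n U \<and> p ` U \<subseteq> dcarrier Y \<and>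
        (\<forall>r\<in>U. \<exists>V. open_Rn n V \<and> r \<in> V \<and> V \<subseteq> U \<and>
           ((\<exists>y. \<forall>s\<in>V. p s = y) \<or>
            (\<exists>a\<in>A. \<exists>q. dplots (Z a) n V q \<and> (\<forall>s\<in>V. p s = g a (q s))))))"

text \<open>P, with maps j : Zb -> P and chi : I^n -> P, is the pushout in Diff of
  Zb <-phi- boundary(I^n) -> I^n (inclusion).\<close>
definition diff_pushout :: "nat \<Rightarrow> ((nat \<Rightarrow> real) \<Rightarrow> 'a) \<Rightarrow> 'a diffsp \<Rightarrow> 'b diffsp
    \<Rightarrow> ('a \<Rightarrow> 'b) \<Rightarrow> ((nat \<Rightarrow> real) \<Rightarrow> 'b) \<Rightarrow> bool" where
  "diff_pushout n \<phi> Zb P j chi \<longleftrightarrow>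
     diffeology P \<and> dsmooth Zb P j \<and> dsmooth (Icube n) P chi \<and>
     (\<forall>x\<in>cube_bdry n. j (\<phi> x) = chi x) \<and>
     dcarrier P = j ` dcarrier Zb \<union> chi ` cube n \<and>
     (let R = {(Inl (\<phi> x), Inr x) | x. x \<in> cube_bdry n}
      in \<forall>u\<in>(dcarrier Zb <+> cube n). \<forall>v\<in>(dcarrier Zb <+> cube n).
           case_sum j chi u = case_sum j chi v \<longleftrightarrow> (u, v) \<in> (R \<union> R\<inverse>)\<^sup>*) \<and>
     (\<forall>m U p. dplots P m U p \<longleftrightarrow>
        open_Rn m U \<and> p ` U \<subseteq> dcarrier P \<and>
        (\<forall>r\<in>U. \<exists>V. open_Rn m V \<and> r \<in> V \<and> V \<subseteq> U \<and>
           ((\<exists>y. \<forall>s\<in>V. p s = y) \<or>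
            (\<exists>q. dplots Zb m V q \<and> (\<forall>s\<in>V. p s = j (q s))) \<or>
            (\<exists>q. dplots (Icube n) m V q \<and> (\<forall>s\<in>V. p s = chi (q s))))))"

section \<open>delta-sequences and smooth cell complexes\<close>

text \<open>The ordinal delta is represented by the well-ordered index type 'i (its elements are the
  ordinals below delta).\<close>

definition is_limit_ord :: "'i::wellorder \<Rightarrow> bool" where
  "is_limit_ord b \<longleftrightarrow> b \<noteq> (LEAST a. True) \<and> (\<forall>a<b. \<exists>c. a < c \<and> c < b)"

definition ord_succ :: "'i::wellorder \<Rightarrow> 'i" where
  "ord_succ b = (LEAST c. b < c)"

definition delta_sequence :: "('i::wellorder \<Rightarrow> 'a diffsp) \<Rightarrow> ('i \<Rightarrow> 'i \<Rightarrow> 'a \<Rightarrow> 'a) \<Rightarrow> bool" where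
  "delta_sequence Z Zm \<longleftrightarrow>
     (\<forall>a. diffeology (Z a)) \<and>
     (\<forall>a b. a \<le> b \<longrightarrow> dsmooth (Z a) (Z b) (Zm a b)) \<and>
     (\<forall>a. \<forall>x\<in>dcarrier (Z a). Zm a a x = x) \<and>
     (\<forall>a b c. a \<le> b \<and> b \<le> c \<longrightarrow> (\<forall>x\<in>dcarrier (Z a). Zm b c (Zm a b x) = Zm a c x)) \<and>
     (\<forall>b. is_limit_ord b \<longrightarrow> diff_colimit {a. a < b} Z Zm (Z b) (\<lambda>a. Zm a b))"

definition smooth_cell_complex :: "'x diffsp \<Rightarrow> ('i::wellorder \<Rightarrow> 'a diffsp) \<Rightarrow> ('i \<Rightarrow> 'i \<Rightarrow> 'a \<Rightarrow> 'a) \<Rightarrow> bool" where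
  "smooth_cell_complex X Z Zm \<longleftrightarrow>
     delta_sequence Z Zm \<and>
     dcarrier (Z (LEAST a. True)) = {} \<and>
     (\<exists>inc. diff_colimit UNIV Z Zm X inc) \<and>
     (\<forall>b. (\<exists>c. b < c) \<longrightarrow>
        (\<exists>n \<phi> chi. dsmooth (dIcube n) (Z b) \<phi> \<and>
           diff_pushout n \<phi> (Z b) (Z (ord_succ b)) (Zm b (ord_succ b)) chi))"

end

theory Submission
  imports Defs "HOL-Computational_Algebra.Polynomial"
begin

text \<open>
  A complex with countably many cells is the union of countably many images of plots, so its
  D-topology is Lindelof, and it suffices to separate: given a point \<open>x\<close> of a D-open set \<open>V\<close>, find a
  smooth \<open>h\<close> with \<open>h x > 1\<close> and \<open>h < 1\<close> off \<open>V\<close>. A standard construction then turns the countably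
  many functions so obtained into a partition of unity, with no local finiteness to be carried
  through the limit stages.

  The function \<open>h\<close> is built by transfinite recursion along the stages. The pointwise condition
  \<open>h < 1\<close> off \<open>V\<close> passes to colimits, unlike a condition on supports. To cross a cell, the function
  on the boundary is first extended to the whole cube by transfinite interpolation; the set where
  the extension is at least 1 off \<open>V\<close> is compact and lies in the interior, so subtracting a large
  multiple of \<open>\<Prod>i. x i * (1 - x i)\<close> restores the condition without changing the boundary values.
\<close>

section \<open>Smooth functions on open subsets of Euclidean space\<close>

lemma smooth_fun_continuous: "smooth_fun n U f \<Longrightarrow> continuous_on U f"
  by (auto simp: smooth_fun_def)

lemma smooth_fun_partial:
  assumes "smooth_fun n U f" "i < n"
  obtains g where "smooth_fun n U g"
    "\<And>x. x \<in> U \<Longrightarrow> ((\<lambda>t. f (x(i := x i + t))) has_real_derivative g x) (at 0)"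
  using assms unfolding smooth_fun_def by metis

text \<open>Smoothness asks for some family closed under partial derivatives, so it is a greatest
  fixed point, and \<open>Collect P\<close> is such a family. This replaces induction on the order
  of differentiation.\<close>

lemma smooth_fun_coinduct:
  assumes "P f"
    and "\<And>g. P g \<Longrightarrow> continuous_on U g"
    and "\<And>g i. P g \<Longrightarrow> i < n \<Longrightarrow>
      \<exists>g'. P g' \<and> (\<forall>x\<in>U. ((\<lambda>t. g (x(i := x i + t))) has_real_derivative g' x) (at 0))"
  shows "smooth_fun n U f"
  unfolding smooth_fun_def using assms by (intro exI[of _ "Collect P"]) auto

lemma smooth_fun_subset: "smooth_fun n U f \<Longrightarrow> V \<subseteq> U \<Longrightarrow> smooth_fun n V f"
  unfolding smooth_fun_def by (meson continuous_on_subset subsetD)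

lemma continuous_on_line:
  fixes x :: "nat \<Rightarrow> real"
  shows "continuous_on A (\<lambda>t. x(i := x i + t))"
proof (rule continuous_on_coordinatewise_then_product)
  fix j show "continuous_on A (\<lambda>t. (x(i := x i + t)) j)"
    by (cases "j = i") (auto intro!: continuous_intros)
qed

lemma continuous_on_coord: "continuous_on A (\<lambda>x :: nat \<Rightarrow> real. x i)"
  by (rule continuous_on_subset[OF continuous_on_product_coordinates]) simp

text \<open>Openness is relative to \<open>Rn n\<close> inside the space of all sequences. Varying a
  coordinate \<open>i < n\<close> does not leave \<open>Rn n\<close>, so an ambient open set
  suffices.\<close>

lemma eventually_line_mem:
  assumes "open_Rn n V" "x \<in> V" "i < n"
  shows "\<forall>\<^sub>F t in nhds 0. x(i := x i + t) \<in> V"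
proof -
  from assms(1) obtain T where T: "open T" "V = Rn n \<inter> T"
    unfolding open_Rn_def openin_open by blast
  have "open ((\<lambda>t. x(i := x i + t)) -` T)"
    using continuous_on_line[of UNIV x i] T(1) by (rule open_vimage[rotated])
  moreover have "x(i := x i + t) \<in> Rn n" for t
    using assms T by (auto simp: Rn_def)
  ultimately show ?thesis
    using assms(2) T(2) unfolding eventually_nhds
    by (intro exI[of _ "(\<lambda>t. x(i := x i + t)) -` T"]) auto
qed

lemma has_real_derivative_line_cong:
  assumes "open_Rn n V" "x \<in> V" "i < n" "\<And>y. y \<in> V \<Longrightarrow> f y = g y"
  shows "((\<lambda>t. f (x(i := x i + t))) has_real_derivative D) (at 0) \<longleftrightarrow>
    ((\<lambda>t. g (x(i := x i + t))) has_real_derivative D) (at 0)"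
  by (rule DERIV_cong_ev)
    (use eventually_line_mem[OF assms(1-3)] assms(4) in \<open>auto elim: eventually_mono\<close>)

lemma smooth_fun_cong:
  assumes "open_Rn n U" "smooth_fun n U f" "\<And>x. x \<in> U \<Longrightarrow> f x = g x"
  shows "smooth_fun n U g"
proof (rule smooth_fun_coinduct[where P = "\<lambda>g. \<exists>f. smooth_fun n U f \<and> (\<forall>x\<in>U. f x = g x)"])
  show "\<exists>f. smooth_fun n U f \<and> (\<forall>x\<in>U. f x = g x)" using assms by blast
next
  fix g assume "\<exists>f. smooth_fun n U f \<and> (\<forall>x\<in>U. f x = g x)"
  then show "continuous_on U g"
    using continuous_on_eq smooth_fun_continuous by blast
next
  fix g i assume "\<exists>f. smooth_fun n U f \<and> (\<forall>x\<in>U. f x = g x)" and i: "i < n"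
  then obtain f where f: "smooth_fun n U f" "\<And>x. x \<in> U \<Longrightarrow> f x = g x" by blast
  obtain f' where f': "smooth_fun n U f'"
    "\<And>x. x \<in> U \<Longrightarrow> ((\<lambda>t. f (x(i := x i + t))) has_real_derivative f' x) (at 0)"
    using smooth_fun_partial[OF f(1) i] by blast
  have "((\<lambda>t. g (x(i := x i + t))) has_real_derivative f' x) (at 0)" if "x \<in> U" for x
    using f'(2)[OF that] has_real_derivative_line_cong[OF assms(1) that i, of f g] f(2) by blast
  with f'(1) show "\<exists>g'. (\<exists>f. smooth_fun n U f \<and> (\<forall>x\<in>U. f x = g' x)) \<and>
      (\<forall>x\<in>U. ((\<lambda>t. g (x(i := x i + t))) has_real_derivative g' x) (at 0))"
    by blast
qed

lemma smooth_fun_local: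
  assumes "open_Rn n U"
    and "\<And>x. x \<in> U \<Longrightarrow> \<exists>V. open_Rn n V \<and> x \<in> V \<and> V \<subseteq> U \<and> smooth_fun n V f"
  shows "smooth_fun n U f"
proof (rule smooth_fun_coinduct[where
      P = "\<lambda>f. \<forall>x\<in>U. \<exists>V. open_Rn n V \<and> x \<in> V \<and> V \<subseteq> U \<and> smooth_fun n V f"])
  show "\<forall>x\<in>U. \<exists>V. open_Rn n V \<and> x \<in> V \<and> V \<subseteq> U \<and> smooth_fun n V f"
    using assms(2) by blast
next
  fix g assume loc: "\<forall>x\<in>U. \<exists>V. open_Rn n V \<and> x \<in> V \<and> V \<subseteq> U \<and> smooth_fun n V g"
  show "continuous_on U g"
    unfolding continuous_on_eq_continuous_within
  proof
    fix x assume "x \<in> U"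
    then obtain V where V: "open_Rn n V" "x \<in> V" "V \<subseteq> U" "smooth_fun n V g" using loc by blast
    have "continuous (at x within V) g"
      using smooth_fun_continuous[OF V(4)] V(2) by (simp add: continuous_on_eq_continuous_within)
    moreover have "at x within V = at x within U"
    proof -
      obtain T where "open T" "V = Rn n \<inter> T"
        using V(1) unfolding open_Rn_def openin_open by blast
      moreover have "U \<subseteq> Rn n"
        using assms(1) unfolding open_Rn_def by (metis openin_imp_subset)
      ultimately have "V = U \<inter> T" using V(3) by auto
      then show ?thesis using V(2) \<open>open T\<close> by (intro at_within_nhd[of x T]) auto
    qed
    ultimately show "continuous (at x within U) g" by simp
  qed
next
  fix g i assume loc: "\<forall>x\<in>U. \<exists>V. open_Rn n V \<and> x \<in> V \<and> V \<subseteq> U \<and> smooth_fun n V g"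
    and i: "i < n"
  \<comment> \<open>The local partial derivatives live on different neighbourhoods. By uniqueness of
    derivatives, \<open>deriv\<close> names them all by one function.\<close>
  define g' where "g' x = deriv (\<lambda>t. g (x(i := x i + t))) 0" for x
  have *: "\<exists>V. open_Rn n V \<and> x \<in> V \<and> V \<subseteq> U \<and> smooth_fun n V g' \<and>
      (\<forall>y\<in>V. ((\<lambda>t. g (y(i := y i + t))) has_real_derivative g' y) (at 0))" if "x \<in> U" for x
  proof -
    obtain V where V: "open_Rn n V" "x \<in> V" "V \<subseteq> U" "smooth_fun n V g" using loc \<open>x \<in> U\<close> by blast
    obtain h where h: "smooth_fun n V h"
      "\<And>x. x \<in> V \<Longrightarrow> ((\<lambda>t. g (x(i := x i + t))) has_real_derivative h x) (at 0)"
      using smooth_fun_partial[OF V(4) i] by blast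
    have eq: "h y = g' y" if "y \<in> V" for y
      unfolding g'_def using DERIV_imp_deriv[OF h(2)[OF that]] by simp
    then have "smooth_fun n V g'" using smooth_fun_cong[OF V(1) h(1)] by blast
    with V h(2) eq show ?thesis by metis
  qed
  show "\<exists>g'. (\<forall>x\<in>U. \<exists>V. open_Rn n V \<and> x \<in> V \<and> V \<subseteq> U \<and> smooth_fun n V g') \<and>
      (\<forall>x\<in>U. ((\<lambda>t. g (x(i := x i + t))) has_real_derivative g' x) (at 0))"
    using * by (intro exI[of _ g']) blast
qed

lemma smooth_fun_const [simp]: "smooth_fun n U (\<lambda>_. c)"
  by (rule smooth_fun_coinduct[where P = "\<lambda>g. \<exists>c. g = (\<lambda>_. c)"]) (auto intro: exI[of _ "\<lambda>_. 0"])

lemma smooth_fun_coord: "smooth_fun n U (\<lambda>x. x i)"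
\<comment> \<open>The candidate adjoins the coordinate to the functions already known to be smooth,
  among which are its partial derivatives, the constants 0 and 1.\<close>
proof (rule smooth_fun_coinduct[where P = "\<lambda>g. g = (\<lambda>x. x i) \<or> smooth_fun n U g"])
  fix g k assume g: "g = (\<lambda>x. x i) \<or> smooth_fun n U g" and k: "k < n"
  show "\<exists>g'. (g' = (\<lambda>x. x i) \<or> smooth_fun n U g') \<and>
      (\<forall>x\<in>U. ((\<lambda>t. g (x(k := x k + t))) has_real_derivative g' x) (at 0))"
  proof (cases "smooth_fun n U g")
    case True then show ?thesis using smooth_fun_partial[OF _ k] by metis
  next
    case False
    then have [simp]: "g = (\<lambda>x. x i)" using g by simp
    show ?thesis
      by (intro exI[of _ "\<lambda>_. if i = k then 1 else 0"])
        (auto intro!: derivative_eq_intros)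
  qed
qed (auto intro: smooth_fun_continuous continuous_on_coord)

section \<open>Closure under sums, products and composition\<close>

text \<open>Derivatives are two-sided in the real line at the points of \<open>S\<close>, as the
  chain rule requires for inner functions with values in \<open>S\<close>. A proper subset such as
  \<open>{0<..}\<close> admits reciprocals.\<close>

definition smooth_real_on :: "real set \<Rightarrow> (real \<Rightarrow> real) \<Rightarrow> bool" where
  "smooth_real_on S h \<longleftrightarrow>
     (\<exists>H. h \<in> H \<and> (\<forall>k\<in>H. \<exists>k'\<in>H. \<forall>t\<in>S. (k has_real_derivative k' t) (at t)))"

lemma smooth_real_on_deriv:
  assumes "smooth_real_on S h"
  obtains h' where "smooth_real_on S h'"
    "\<And>t. t \<in> S \<Longrightarrow> (h has_real_derivative h' t) (at t)"
  using assms unfolding smooth_real_on_def by metis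

inductive_set smooth_generated :: "nat \<Rightarrow> (nat \<Rightarrow> real) set \<Rightarrow> ((nat \<Rightarrow> real) \<Rightarrow> real) set"
  for n U where
  base: "smooth_fun n U f \<Longrightarrow> f \<in> smooth_generated n U"
| add: "f \<in> smooth_generated n U \<Longrightarrow> g \<in> smooth_generated n U \<Longrightarrow>
    (\<lambda>x. f x + g x) \<in> smooth_generated n U"
| mult: "f \<in> smooth_generated n U \<Longrightarrow> g \<in> smooth_generated n U \<Longrightarrow>
    (\<lambda>x. f x * g x) \<in> smooth_generated n U"
| comp: "smooth_fun n U f \<Longrightarrow> f ` U \<subseteq> S \<Longrightarrow> smooth_real_on S h \<Longrightarrow>
    (\<lambda>x. h (f x)) \<in> smooth_generated n U"

text \<open>The coinduction candidate for sums, products and compositions alike: it contains the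
  partial derivatives of its members by the sum, product and chain rules.\<close>

lemma smooth_generated_smooth:
  assumes "f \<in> smooth_generated n U"
  shows "smooth_fun n U f"
proof (rule smooth_fun_coinduct[where P = "\<lambda>f. f \<in> smooth_generated n U"])
  show "f \<in> smooth_generated n U" by fact
next
  fix g assume "g \<in> smooth_generated n U"
  then show "continuous_on U g"
  proof induction
    case (comp f S h)
    have "continuous_on S h"
      using comp.hyps(3) smooth_real_on_deriv
      by (metis DERIV_isCont continuous_at_imp_continuous_on)
    then show ?case
      using comp.hyps(2) smooth_fun_continuous[OF comp.hyps(1)] continuous_on_compose2 by metis
  qed (auto intro: smooth_fun_continuous continuous_intros)
next
  fix g i assume "g \<in> smooth_generated n U" and i: "i < n"
  then show "\<exists>g'. g' \<in> smooth_generated n U \<and>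
      (\<forall>x\<in>U. ((\<lambda>t. g (x(i := x i + t))) has_real_derivative g' x) (at 0))"
  proof induction
    case (base f)
    then show ?case using smooth_fun_partial[OF _ i] smooth_generated.base by metis
  next
    case (add f g)
    then obtain f' g' where *: "f' \<in> smooth_generated n U" "g' \<in> smooth_generated n U"
      "\<forall>x\<in>U. ((\<lambda>t. f (x(i := x i + t))) has_real_derivative f' x) (at 0)"
      "\<forall>x\<in>U. ((\<lambda>t. g (x(i := x i + t))) has_real_derivative g' x) (at 0)" by blast
    have "((\<lambda>t. f (x(i := x i + t)) + g (x(i := x i + t))) has_real_derivative f' x + g' x) (at 0)"
      if "x \<in> U" for x
      using DERIV_add[OF *(3)[rule_format, OF that] *(4)[rule_format, OF that]] .
    with smooth_generated.add[OF *(1,2)] show ?case by blast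
  next
    case (mult f g)
    then obtain f' g' where *: "f' \<in> smooth_generated n U" "g' \<in> smooth_generated n U"
      "\<forall>x\<in>U. ((\<lambda>t. f (x(i := x i + t))) has_real_derivative f' x) (at 0)"
      "\<forall>x\<in>U. ((\<lambda>t. g (x(i := x i + t))) has_real_derivative g' x) (at 0)" by blast
    have "((\<lambda>t. f (x(i := x i + t)) * g (x(i := x i + t))) has_real_derivative
        f' x * g x + g' x * f x) (at 0)" if "x \<in> U" for x
      using DERIV_mult[OF *(3)[rule_format, OF that] *(4)[rule_format, OF that]] by simp
    moreover have "(\<lambda>x. f' x * g x + g' x * f x) \<in> smooth_generated n U"
      using smooth_generated.add[OF smooth_generated.mult[OF *(1) mult.hyps(2)]
          smooth_generated.mult[OF *(2) mult.hyps(1)]] .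
    ultimately show ?case by blast
  next
    case (comp f S h)
    obtain f' where f': "smooth_fun n U f'"
      "\<And>x. x \<in> U \<Longrightarrow> ((\<lambda>t. f (x(i := x i + t))) has_real_derivative f' x) (at 0)"
      using smooth_fun_partial[OF comp.hyps(1) i] by blast
    obtain h' where h': "smooth_real_on S h'"
      "\<And>t. t \<in> S \<Longrightarrow> (h has_real_derivative h' t) (at t)"
      using smooth_real_on_deriv[OF comp.hyps(3)] by blast
    have "((\<lambda>t. h (f (x(i := x i + t)))) has_real_derivative h' (f x) * f' x) (at 0)"
      if "x \<in> U" for x
      using h'(2)[of "f x"] f'(2)[OF that] that comp.hyps(2)
      by (intro DERIV_chain2[where f = h]) auto
    moreover have "(\<lambda>x. h' (f x) * f' x) \<in> smooth_generated n U"
      using smooth_generated.mult[OF smooth_generated.comp[OF comp.hyps(1,2) h'(1)]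
          smooth_generated.base[OF f'(1)]] .
    ultimately show ?case by blast
  qed
qed

lemma smooth_fun_add: "smooth_fun n U f \<Longrightarrow> smooth_fun n U g \<Longrightarrow> smooth_fun n U (\<lambda>x. f x + g x)"
  by (rule smooth_generated_smooth[OF smooth_generated.add[OF smooth_generated.base smooth_generated.base]])

lemma smooth_fun_mult: "smooth_fun n U f \<Longrightarrow> smooth_fun n U g \<Longrightarrow> smooth_fun n U (\<lambda>x. f x * g x)"
  by (rule smooth_generated_smooth[OF smooth_generated.mult[OF smooth_generated.base smooth_generated.base]])

lemma smooth_fun_comp:
  "smooth_real_on S h \<Longrightarrow> smooth_fun n U f \<Longrightarrow> f ` U \<subseteq> S \<Longrightarrow> smooth_fun n U (\<lambda>x. h (f x))"
  by (rule smooth_generated_smooth[OF smooth_generated.comp])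

lemma smooth_fun_diff:
  assumes "smooth_fun n U f" "smooth_fun n U g"
  shows "smooth_fun n U (\<lambda>x. f x - g x)"
  using smooth_fun_add[OF assms(1) smooth_fun_mult[OF smooth_fun_const[of n U "-1"] assms(2)]] by simp

lemma smooth_fun_sum:
  "(\<And>k. k \<in> K \<Longrightarrow> smooth_fun n U (f k)) \<Longrightarrow> smooth_fun n U (\<lambda>x. \<Sum>k\<in>K. f k x)"
  by (induction K rule: infinite_finite_induct) (auto intro: smooth_fun_add)

lemma smooth_fun_prod:
  "(\<And>k. k \<in> K \<Longrightarrow> smooth_fun n U (f k)) \<Longrightarrow> smooth_fun n U (\<lambda>x. \<Prod>k\<in>K. f k x)"
  by (induction K rule: infinite_finite_induct) (auto intro: smooth_fun_mult)

section \<open>Sine, reciprocal and a flat function\<close>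

lemma smooth_real_on_sin: "smooth_real_on S sin"
  unfolding smooth_real_on_def
  by (rule exI[of _ "{sin, cos, \<lambda>t. - sin t, \<lambda>t. - cos t}"]) (auto intro!: derivative_eq_intros)

text \<open>The functions \<open>c * inverse t ^ k\<close> form a family closed under
  differentiation on the positive half-line.\<close>

lemma smooth_real_on_inverse: "smooth_real_on {0<..} inverse"
  unfolding smooth_real_on_def
proof (intro exI conjI ballI)
  show "inverse \<in> range (\<lambda>(c, k) t. c * inverse t ^ k :: real)"
    by (rule range_eqI[of _ _ "(1, 1)"]) auto
next
  fix f :: "real \<Rightarrow> real" assume "f \<in> range (\<lambda>(c, k) t. c * inverse t ^ k)"
  then obtain c k where [simp]: "f = (\<lambda>t. c * inverse t ^ k)" by auto
  have "(f has_real_derivative - c * k * inverse t ^ Suc k) (at t)" if "t \<in> {0<..}" for t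
  proof -
    have "(f has_real_derivative c * (k * (- (inverse t ^ Suc (Suc 0)) * inverse t ^ (k - Suc 0)))) (at t)"
      unfolding \<open>f = _\<close> using that by (intro DERIV_cmult DERIV_power DERIV_inverse) auto
    \<comment> \<open>For \<open>k = 0\<close> the truncated exponent \<open>k - Suc 0\<close> is
      harmless, since the factor \<open>k\<close> vanishes.\<close>
    moreover have "c * (k * (- (inverse t ^ Suc (Suc 0)) * inverse t ^ (k - Suc 0))) =
        - c * k * inverse t ^ Suc k"
      by (cases k) auto
    ultimately show ?thesis by (simp only:)
  qed
  then show "\<exists>k'\<in>range (\<lambda>(c, k) t. c * inverse t ^ k). \<forall>t\<in>{0<..}. (f has_real_derivative k' t) (at t)"
    by (intro bexI[of _ "\<lambda>t. (- c * k) * inverse t ^ Suc k"])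
      (auto intro!: range_eqI[of _ _ "(- c * k, Suc k)"])
qed

text \<open>The classical smooth function that is not analytic at 0. Composing with it cuts a smooth
  function off where it is not positive.\<close>

definition flat :: "real \<Rightarrow> real" where
  "flat t = (if 0 < t then exp (- inverse t) else 0)"

lemma flat_nonneg [simp]: "0 \<le> flat t" and flat_pos_iff: "0 < flat t \<longleftrightarrow> 0 < t"
  and flat_eq_0_iff: "flat t = 0 \<longleftrightarrow> t \<le> 0"
  by (auto simp: flat_def)

lemma tendsto_poly_mult_exp_minus:
  fixes P :: "real poly"
  shows "((\<lambda>u. poly P u * exp (- u)) \<longlongrightarrow> 0) at_top"
proof -
  have "((\<lambda>u. \<Sum>k\<le>degree P. coeff P k * (u ^ k / exp u)) \<longlongrightarrow> (\<Sum>k\<le>degree P. coeff P k * 0)) at_top"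
    by (intro tendsto_intros tendsto_power_div_exp_0)
  moreover have "(\<Sum>k\<le>degree P. coeff P k * (u ^ k / exp u)) = poly P u * exp (- u)" for u
    by (simp add: poly_altdef sum_distrib_right exp_minus divide_inverse mult.assoc)
  ultimately show ?thesis by simp
qed

text \<open>The functions equal to \<open>poly P (inverse t) * exp (- inverse t)\<close> for
  \<open>t > 0\<close> and to 0 elsewhere are closed under differentiation: at 0 the exponential
  decay beats every polynomial.\<close>

lemma smooth_real_on_flat: "smooth_real_on S flat"
  unfolding smooth_real_on_def
proof (intro exI conjI ballI)
  let ?F = "\<lambda>P t. if 0 < t then poly P (inverse t) * exp (- inverse t) else (0 :: real)"
  show "flat \<in> range ?F"
    by (rule range_eqI[of _ _ 1]) (auto simp: flat_def)
  fix f assume "f \<in> range ?F"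
  then obtain P where f: "f = ?F P" by auto
  \<comment> \<open>With \<open>u = inverse t\<close>, whose derivative is \<open>- u^2\<close>, the
    derivative of \<open>P(u) * exp (- u)\<close> is
    \<open>u^2 * (P - P')(u) * exp (- u)\<close>.\<close>
  define Q where "Q = [:0, 0, 1:] * (P - pderiv P)"
  have "(f has_real_derivative ?F Q t) (at t)" for t
  proof -
    consider "t < 0" | "t = 0" | "t > 0" by linarith
    then show ?thesis
    proof cases
      case 1
      have "((\<lambda>t. 0) has_real_derivative 0) (at t)" by simp
      then have "(f has_real_derivative 0) (at t)"
        by (rule has_field_derivative_transform_within_open[of _ _ _ "{..<0}"]) (use 1 in \<open>auto simp: f\<close>)
      with 1 show ?thesis by simp
    next
      case 2
      have "((\<lambda>h. f h / h) \<longlongrightarrow> 0) (at_left 0)"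
        by (rule tendsto_eventually) (auto simp: f eventually_at_filter)
      \<comment> \<open>Substituting \<open>inverse u\<close> for \<open>h\<close> turns the
        right-hand difference quotient into \<open>u * P(u) * exp (- u)\<close>.\<close>
      moreover have "((\<lambda>h. f h / h) \<longlongrightarrow> 0) (at_right 0)"
        unfolding filterlim_at_right_to_top
      proof (rule Lim_transform_eventually[OF tendsto_poly_mult_exp_minus[of "[:0, 1:] * P"]])
        show "\<forall>\<^sub>F u in at_top. poly ([:0, 1:] * P) u * exp (- u) = f (inverse u) / inverse u"
          using eventually_gt_at_top[of 0] by eventually_elim (simp add: f field_simps)
      qed
      ultimately have "((\<lambda>h. f h / h) \<longlongrightarrow> 0) (at 0)" by (rule filterlim_split_at)
      moreover have "f 0 = 0" by (simp add: f)
      ultimately show ?thesis using 2 by (simp add: DERIV_def)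
    next
      case 3
      have "((\<lambda>t. poly P (inverse t) * exp (- inverse t)) has_real_derivative ?F Q t) (at t)"
        using 3 by (auto intro!: derivative_eq_intros DERIV_chain2[OF poly_DERIV]
            simp: Q_def field_simps power2_eq_square)
      then show ?thesis
        by (rule has_field_derivative_transform_within_open[of _ _ _ "{0<..}"]) (use 3 in \<open>auto simp: f\<close>)
    qed
  qed
  then show "\<exists>f'\<in>range ?F. \<forall>t\<in>S. (f has_real_derivative f' t) (at t)"
    by (intro bexI[of _ "?F Q"]) auto
qed

section \<open>Extending functions over a cell\<close>

lemma dsmooth_real_plot: "dsmooth_real X f \<Longrightarrow> dplots X n U p \<Longrightarrow> smooth_fun n U (\<lambda>x. f (p x))"
  by (auto simp: dsmooth_real_def comp_def)

lemma dsmooth_realI: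
  "(\<And>n U p. dplots X n U p \<Longrightarrow> smooth_fun n U (\<lambda>x. f (p x))) \<Longrightarrow> dsmooth_real X f"
  by (auto simp: dsmooth_real_def comp_def)

lemma dsmooth_real_const [simp]: "dsmooth_real X (\<lambda>_. c)"
  by (rule dsmooth_realI) simp

lemma dsmooth_real_add:
  "dsmooth_real X f \<Longrightarrow> dsmooth_real X g \<Longrightarrow> dsmooth_real X (\<lambda>x. f x + g x)"
  by (rule dsmooth_realI) (intro smooth_fun_add dsmooth_real_plot)

lemma dsmooth_real_diff:
  "dsmooth_real X f \<Longrightarrow> dsmooth_real X g \<Longrightarrow> dsmooth_real X (\<lambda>x. f x - g x)"
  by (rule dsmooth_realI) (intro smooth_fun_diff dsmooth_real_plot)

lemma dsmooth_real_mult: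
  "dsmooth_real X f \<Longrightarrow> dsmooth_real X g \<Longrightarrow> dsmooth_real X (\<lambda>x. f x * g x)"
  by (rule dsmooth_realI) (intro smooth_fun_mult dsmooth_real_plot)

lemma dsmooth_real_sum:
  "(\<And>k. k \<in> K \<Longrightarrow> dsmooth_real X (f k)) \<Longrightarrow> dsmooth_real X (\<lambda>x. \<Sum>k\<in>K. f k x)"
  by (rule dsmooth_realI) (intro smooth_fun_sum dsmooth_real_plot)

lemma dsmooth_real_prod:
  "(\<And>k. k \<in> K \<Longrightarrow> dsmooth_real X (f k)) \<Longrightarrow> dsmooth_real X (\<lambda>x. \<Prod>k\<in>K. f k x)"
  by (rule dsmooth_realI) (intro smooth_fun_prod dsmooth_real_plot)

lemma dsmooth_real_flat: "dsmooth_real X f \<Longrightarrow> dsmooth_real X (\<lambda>x. flat (f x))"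
  by (rule dsmooth_realI, rule smooth_fun_comp[OF smooth_real_on_flat[of UNIV]])
    (auto intro: dsmooth_real_plot)

lemma dsmooth_dsmooth_real:
  assumes "dsmooth X Y g" "dsmooth_real Y f"
  shows "dsmooth_real X (\<lambda>x. f (g x))"
proof (rule dsmooth_realI)
  fix n U p assume "dplots X n U p"
  then have "dplots Y n U (g \<circ> p)" using assms(1) by (simp add: dsmooth_def)
  then show "smooth_fun n U (\<lambda>x. f (g (p x)))"
    using dsmooth_real_plot[OF assms(2)] by fastforce
qed

section \<open>Extension from the boundary to the cube\<close>

lemma dplots_Icube:
  "dplots (Icube n) m U p \<longleftrightarrow> open_Rn m U \<and> smooth_map m U n p \<and> p ` U \<subseteq> cube n"
  by (simp add: Icube_def subspace_def Rn_diff_def)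

lemma dplots_dIcube:
  "dplots (dIcube n) m U p \<longleftrightarrow> open_Rn m U \<and> smooth_map m U n p \<and> p ` U \<subseteq> cube_bdry n"
  by (simp add: dIcube_def subspace_def Rn_diff_def)

lemma dsmooth_real_Icube_coord: "i < n \<Longrightarrow> dsmooth_real (Icube n) (\<lambda>x. x i)"
  by (rule dsmooth_realI) (auto simp: dplots_Icube smooth_map_def)

lemma smooth_map_fun_upd:
  assumes "smooth_map m U n p" "k < n"
  shows "smooth_map m U n (\<lambda>x. (p x)(k := e))"
  unfolding smooth_map_def
proof (intro conjI ballI allI impI)
  fix x assume "x \<in> U" then show "(p x)(k := e) \<in> Rn n"
    using assms by (auto simp: smooth_map_def Rn_def)
next
  fix i assume "i < n" then show "smooth_fun m U (\<lambda>x. ((p x)(k := e)) i)"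
    using assms(1) by (cases "i = k") (auto simp: smooth_map_def)
qed

lemma cube_fun_upd: "x \<in> cube n \<Longrightarrow> k < n \<Longrightarrow> e = 0 \<or> e = 1 \<Longrightarrow> x(k := e) \<in> cube_bdry n"
  by (auto simp: cube_bdry_def cube_def Rn_def)

lemma cube_bdry_subset: "cube_bdry n \<subseteq> cube n"
  by (auto simp: cube_bdry_def)

text \<open>Transfinite interpolation: interpolating the defect linearly in direction \<open>k\<close> corrects the
  values on the two faces \<open>x k = 0\<close> and \<open>x k = 1\<close> and does not disturb the values on faces treated
  before, where the defect vanishes. Only values of \<open>f\<close> on the boundary enter, and the maps
  \<open>x \<mapsto> x(k := e)\<close> are smooth from the cube to its boundary.\<close>

lemma cube_bdry_extend:
  assumes f: "dsmooth_real (dIcube n) f"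
  obtains F where "dsmooth_real (Icube n) F" "\<And>x. x \<in> cube_bdry n \<Longrightarrow> F x = f x"
proof -
  have "\<exists>F. dsmooth_real (Icube n) F \<and>
      (\<forall>x\<in>cube n. \<forall>i<k. x i = 0 \<or> x i = 1 \<longrightarrow> F x = f x)" if "k \<le> n" for k
    using that
  proof (induction k)
    case 0
    show ?case by (intro exI[of _ "\<lambda>_. 0"]) auto
  next
    case (Suc k)
    then obtain F where F: "dsmooth_real (Icube n) F"
      "\<And>x i. x \<in> cube n \<Longrightarrow> i < k \<Longrightarrow> x i = 0 \<or> x i = 1 \<Longrightarrow> F x = f x" by auto
    have k: "k < n" using Suc.prems by simp
    define g where "g e x = f (x(k := e)) - F (x(k := e))" for e x
    have g: "dsmooth_real (Icube n) (g e)" if e: "e = 0 \<or> e = 1" for e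
    proof (rule dsmooth_realI)
      fix m U p assume p: "dplots (Icube n) m U p"
      have "(p x)(k := e) \<in> cube_bdry n" if "x \<in> U" for x
        using p that cube_fun_upd[OF _ k e] by (auto simp: dplots_Icube)
      then have "dplots (dIcube n) m U (\<lambda>x. (p x)(k := e))"
        "dplots (Icube n) m U (\<lambda>x. (p x)(k := e))"
        using p smooth_map_fun_upd[OF _ k]
        by (auto simp: dplots_Icube dplots_dIcube intro: subsetD[OF cube_bdry_subset])
      then show "smooth_fun m U (\<lambda>x. g e (p x))"
        unfolding g_def by (intro smooth_fun_diff dsmooth_real_plot[OF f] dsmooth_real_plot[OF F(1)])
    qed
    define F' where "F' x = F x + ((1 - x k) * g 0 x + x k * g 1 x)" for x
    have "dsmooth_real (Icube n) F'"
      unfolding F'_def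
      by (intro dsmooth_real_add dsmooth_real_mult dsmooth_real_diff dsmooth_real_const
          dsmooth_real_Icube_coord F(1) g k) auto
    moreover have "F' x = f x" if x: "x \<in> cube n" and i: "i < Suc k" "x i = 0 \<or> x i = 1" for x i
    proof (cases "i = k")
      case True
      then show ?thesis using i(2) fun_upd_idem[of x k 0] fun_upd_idem[of x k 1] by (auto simp: F'_def g_def)
    next
      case False
      then have "i < k" using i by simp
      moreover have "x(k := e) \<in> cube n" if "e = 0 \<or> e = 1" for e
        using cube_fun_upd[OF x k that] cube_bdry_subset by blast
      ultimately have "g e x = 0" if "e = 0 \<or> e = 1" for e
        unfolding g_def using F(2)[of "x(k := e)" i] i that by auto
      then show ?thesis using F(2)[OF x \<open>i < k\<close> i(2)] by (simp add: F'_def)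
    qed
    ultimately show ?case by blast
  qed
  from this[of n] show thesis
    using that cube_bdry_subset by (fastforce simp: cube_bdry_def)
qed

section \<open>A smooth parametrization of the cube\<close>

text \<open>A smooth surjection from all of \<open>Rn n\<close> onto the cube, which thereby is the
  image of a single plot. Coordinates from \<open>n\<close> on stay 0.\<close>

definition cube_param :: "(nat \<Rightarrow> real) \<Rightarrow> nat \<Rightarrow> real" where
  "cube_param x = (\<lambda>i. (sin (x i))\<^sup>2)"

lemma open_Rn_Rn [simp]: "open_Rn n (Rn n)"
  by (simp add: open_Rn_def)

lemma dplots_cube_param: "dplots (Icube n) n (Rn n) cube_param"
proof -
  have "smooth_fun n (Rn n) (\<lambda>x. cube_param x i)" for i
    unfolding cube_param_def power2_eq_square
    by (intro smooth_fun_mult smooth_fun_comp[OF smooth_real_on_sin[of UNIV]] smooth_fun_coord) auto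
  moreover have "cube_param x \<in> cube n" if "x \<in> Rn n" for x
    using that by (auto simp: cube_param_def cube_def Rn_def abs_square_le_1)
  ultimately show ?thesis
    by (auto simp: dplots_Icube smooth_map_def cube_def)
qed

text \<open>The preimage \<open>arcsin (sqrt (y i))\<close> already lies in a compact box, so
  extrema can be taken on the parameter side.\<close>

lemma cube_param_surj:
  "cube n \<subseteq> cube_param ` {x \<in> Rn n. \<forall>i<n. 0 \<le> x i \<and> x i \<le> pi / 2}"
proof
  fix y assume y: "y \<in> cube n"
  let ?x = "\<lambda>i. arcsin (sqrt (y i))"
  have "cube_param ?x i = y i" for i
    using y sin_arcsin[of "sqrt (y i)"] order_trans[of "-1" 0 "sqrt (y i)"]
    by (cases "i < n") (auto simp: cube_param_def cube_def Rn_def)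
  moreover have "?x i = 0" if "i \<ge> n" for i using y that by (auto simp: cube_def Rn_def)
  moreover have "0 \<le> ?x i \<and> ?x i \<le> pi / 2" if "i < n" for i
    using y that arcsin_le_arcsin[of 0 "sqrt (y i)"] arcsin_ubound[of "sqrt (y i)"]
      order_trans[of "-1" 0 "sqrt (y i)"]
    by (auto simp: cube_def intro: order_trans[of _ 0])
  ultimately show "y \<in> cube_param ` {x \<in> Rn n. \<forall>i<n. 0 \<le> x i \<and> x i \<le> pi / 2}"
    by (intro image_eqI[of _ _ ?x]) (auto simp: Rn_def)
qed

text \<open>In the product topology the box is a product of compact factors, intervals below
  \<open>n\<close> and \<open>{0}\<close> from \<open>n\<close> on.\<close>

lemma compact_box_Rn: "compact {x \<in> Rn n. \<forall>i<n. a \<le> x i \<and> x i \<le> (b :: real)}"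
proof -
  have "{x \<in> Rn n. \<forall>i<n. a \<le> x i \<and> x i \<le> b} = (\<Pi>\<^sub>E i\<in>UNIV. if i < n then {a..b} else {0})"
    by (auto simp: Rn_def PiE_UNIV_domain Pi_iff split: if_splits)
  moreover have "compactin (product_topology (\<lambda>_. euclidean) UNIV)
      (\<Pi>\<^sub>E i\<in>UNIV. if i < n then {a..b} else {0})"
    by (auto simp: compactin_PiE)
  ultimately show ?thesis by (simp add: euclidean_product_topology)
qed

section \<open>Bump function and controlled extension over a cell\<close>

text \<open>On the cube it vanishes exactly at the boundary. For \<open>n = 0\<close> the empty
  product 1 is right, as the 0-cube has empty boundary.\<close>

definition cube_bump :: "nat \<Rightarrow> (nat \<Rightarrow> real) \<Rightarrow> real" where
  "cube_bump n x = (\<Prod>i<n. x i * (1 - x i))"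

lemma cube_bump_nonneg: "x \<in> cube n \<Longrightarrow> 0 \<le> cube_bump n x"
  unfolding cube_bump_def by (rule prod_nonneg) (auto simp: cube_def)

lemma cube_bump_bdry: "x \<in> cube_bdry n \<Longrightarrow> cube_bump n x = 0"
  unfolding cube_bump_def by (auto simp: cube_bdry_def)

lemma cube_bump_pos: "x \<in> cube n \<Longrightarrow> x \<notin> cube_bdry n \<Longrightarrow> 0 < cube_bump n x"
  unfolding cube_bump_def
  by (rule prod_pos) (auto simp: cube_def cube_bdry_def less_le intro!: mult_pos_pos)

lemma dsmooth_cube_bump: "dsmooth_real (Icube n) (cube_bump n)"
  unfolding cube_bump_def
  by (intro dsmooth_real_prod dsmooth_real_mult dsmooth_real_diff dsmooth_real_const
      dsmooth_real_Icube_coord) auto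

text \<open>Compactness is used on the domain of \<open>cube_param\<close>, so no comparison of the D-topology of the
  cube with its Euclidean topology is needed.\<close>

lemma cube_push_below:
  assumes F: "dsmooth_real (Icube n) F" and h: "dsmooth_real (Icube n) h"
    and V: "open_Rn n {x \<in> Rn n. cube_param x \<in> V}"
    and nonneg: "\<And>y. y \<in> cube n \<Longrightarrow> 0 \<le> h y"
    and pos: "\<And>y. y \<in> cube n \<Longrightarrow> y \<notin> V \<Longrightarrow> 1 \<le> F y \<Longrightarrow> 0 < h y"
  obtains M where "\<And>y. y \<in> cube n \<Longrightarrow> y \<notin> V \<Longrightarrow> F y - M * h y < 1"
proof -
  define Q where "Q = {x \<in> Rn n. \<forall>i<n. 0 \<le> x i \<and> x i \<le> pi / 2}"
  \<comment> \<open>\<open>K\<close> parametrizes the points that need a correction: those off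
    \<open>V\<close> with value at least 1. It is compact because the preimage of \<open>V\<close>
    is open.\<close>
  define K where "K = {x \<in> Q. 1 \<le> F (cube_param x)} \<inter> {x. cube_param x \<notin> V}"
  have Q: "compact Q" "Q \<subseteq> Rn n"
    unfolding Q_def by (rule compact_box_Rn) auto
  have param: "cube_param x \<in> cube n" if "x \<in> Rn n" for x
    using dplots_cube_param[of n] that by (auto simp: dplots_Icube)
  have cont: "continuous_on Q (\<lambda>x. G (cube_param x))" if "dsmooth_real (Icube n) G" for G
    using smooth_fun_continuous[OF dsmooth_real_plot[OF that dplots_cube_param]] Q(2)
    by (rule continuous_on_subset)
  obtain T where T: "open T" "{x \<in> Rn n. cube_param x \<in> V} = Rn n \<inter> T"
    using V unfolding open_Rn_def openin_open by blast
  have "closed {x \<in> Q. 1 \<le> F (cube_param x)}"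
    using continuous_on_closed_Collect_le[OF continuous_on_const cont[OF F]] Q compact_imp_closed
    by blast
  moreover have K_eq: "K = {x \<in> Q. 1 \<le> F (cube_param x)} - T"
    using T(2) Q(2) unfolding K_def by blast
  ultimately have "closed K" using T(1) by (simp add: closed_Diff)
  moreover have "K = Q \<inter> K" by (auto simp: K_def)
  ultimately have K: "compact K" using Q(1) compact_Int_closed by metis
  have "K \<subseteq> Q" by (auto simp: K_def)
  \<comment> \<open>\<open>M\<close> is nonnegative so that subtracting \<open>M * h\<close> does
    not raise the values where \<open>F\<close> is already below 1.\<close>
  have "\<exists>M\<ge>0. \<forall>x\<in>K. F (cube_param x) - M * h (cube_param x) < 1"
  proof (cases "K = {}")
    case False
    obtain u where u: "u \<in> K" "\<And>x. x \<in> K \<Longrightarrow> h (cube_param u) \<le> h (cube_param x)"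
      using continuous_attains_inf[OF K False continuous_on_subset[OF cont[OF h] \<open>K \<subseteq> Q\<close>]] by blast
    obtain v where v: "v \<in> K" "\<And>x. x \<in> K \<Longrightarrow> F (cube_param x) \<le> F (cube_param v)"
      using continuous_attains_sup[OF K False continuous_on_subset[OF cont[OF F] \<open>K \<subseteq> Q\<close>]] by blast
    \<comment> \<open>The minimum of \<open>h\<close> and the maximum of \<open>F\<close> on
      \<open>K\<close>. With \<open>M = B / c\<close> at least \<open>B\<close> is subtracted, which
      leaves a value of at most 0.\<close>
    define c B where "c = h (cube_param u)" and "B = F (cube_param v)"
    have c: "0 < c" using u(1) pos[OF param] Q(2) by (auto simp: K_def c_def)
    have B: "1 \<le> B" using v(1) by (auto simp: K_def B_def)
    have "F (cube_param x) - B / c * h (cube_param x) < 1" if "x \<in> K" for x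
    proof -
      have "B / c * c \<le> B / c * h (cube_param x)"
        using u(2)[OF that] c B by (intro mult_left_mono) (auto simp: c_def)
      then show ?thesis using v(2)[OF that] c B by (simp add: B_def)
    qed
    then show ?thesis using c B by (intro exI[of _ "B / c"]) auto
  qed auto
  then obtain M where M: "M \<ge> 0" "\<And>x. x \<in> K \<Longrightarrow> F (cube_param x) - M * h (cube_param x) < 1" by blast
  have "F y - M * h y < 1" if y: "y \<in> cube n" "y \<notin> V" for y
  proof (cases "1 \<le> F y")
    case True
    obtain x where "x \<in> Q" "y = cube_param x" using cube_param_surj y(1) unfolding Q_def by blast
    then show ?thesis using M(2)[of x] True y(2) by (auto simp: K_def)
  next
    case False
    moreover have "0 \<le> M * h y" using M(1) nonneg[OF y(1)] by simp
    ultimately show ?thesis by linarith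
  qed
  then show thesis using that by blast
qed

text \<open>An extension of \<open>f\<close> is corrected twice by functions vanishing on the
  boundary. A multiple of the bump sets the value at \<open>z\<close> to 2; then a multiple of
  \<open>h\<close>, which vanishes at \<open>z\<close> if \<open>z\<close> is in \<open>V\<close>,
  pushes the values off \<open>V\<close> below 1.\<close>

lemma cell_extend:
  assumes f: "dsmooth_real (dIcube n) f" and below: "\<And>y. y \<in> cube_bdry n \<Longrightarrow> y \<notin> V \<Longrightarrow> f y < 1"
    and V: "open_Rn n {x \<in> Rn n. cube_param x \<in> V}"
    and z: "z \<in> cube n" "z \<notin> cube_bdry n"
  obtains F where "dsmooth_real (Icube n) F" "\<And>y. y \<in> cube_bdry n \<Longrightarrow> F y = f y"
    "\<And>y. y \<in> cube n \<Longrightarrow> y \<notin> V \<Longrightarrow> F y < 1" "z \<in> V \<Longrightarrow> F z = 2"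
proof -
  obtain E where E: "dsmooth_real (Icube n) E" "\<And>x. x \<in> cube_bdry n \<Longrightarrow> E x = f x"
    using cube_bdry_extend[OF f] by blast
  define F where "F y = E y + (2 - E z) / cube_bump n z * cube_bump n y" for y
  \<comment> \<open>If \<open>z\<close> is in \<open>V\<close>, the squared distance from
    \<open>z\<close> vanishes at \<open>z\<close> and is positive at the cube points off
    \<open>V\<close>. Otherwise no value at \<open>z\<close> is prescribed and \<open>d\<close> must
    be positive there too.\<close>
  define d where "d y = (if z \<in> V then \<Sum>i<n. (y i - z i) * (y i - z i) else 1)" for y :: "nat \<Rightarrow> real"
  define h where "h y = cube_bump n y * d y" for y
  have F: "dsmooth_real (Icube n) F"
    unfolding F_def
    by (intro dsmooth_real_add dsmooth_real_mult E(1) dsmooth_real_const dsmooth_cube_bump)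
  have "dsmooth_real (Icube n) d"
    unfolding d_def
    by (cases "z \<in> V") (auto intro!: dsmooth_real_sum dsmooth_real_mult dsmooth_real_diff
        dsmooth_real_const dsmooth_real_Icube_coord)
  then have h: "dsmooth_real (Icube n) h"
    unfolding h_def by (intro dsmooth_real_mult dsmooth_cube_bump)
  have d_nonneg: "0 \<le> d y" for y
    by (auto simp: d_def intro: sum_nonneg)
  have d_pos: "0 < d y" if y: "y \<in> cube n" "y \<notin> V" for y
  proof (cases "z \<in> V")
    case True
    then obtain i where "y i \<noteq> z i" using y(2) by (metis ext)
    moreover from this have "i < n" using y(1) z(1) by (cases "i < n") (auto simp: cube_def Rn_def)
    ultimately have "0 < (\<Sum>i<n. (y i - z i) * (y i - z i))"
      by (intro sum_pos2[of _ i]) (auto simp: zero_less_mult_iff)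
    then show ?thesis using True by (simp add: d_def)
  qed (simp add: d_def)
  have F_bdry: "F y = f y" if "y \<in> cube_bdry n" for y
    using that E(2) cube_bump_bdry by (simp add: F_def)
  \<comment> \<open>Boundary points off \<open>V\<close> have value below 1, so
    \<open>1 \<le> F y\<close> forces \<open>y\<close> into the interior, where the bump is
    positive.\<close>
  have "0 < h y" if "y \<in> cube n" "y \<notin> V" "1 \<le> F y" for y
    using that F_bdry[of y] below[of y] cube_bump_pos[of y n] d_pos[of y] by (force simp: h_def)
  moreover have "0 \<le> h y" if "y \<in> cube n" for y
    using cube_bump_nonneg[OF that] d_nonneg[of y] by (simp add: h_def)
  ultimately obtain M where M: "\<And>y. y \<in> cube n \<Longrightarrow> y \<notin> V \<Longrightarrow> F y - M * h y < 1"
    using cube_push_below[OF F h V] by blast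
  show thesis
  proof
    show "dsmooth_real (Icube n) (\<lambda>y. F y - M * h y)"
      by (intro dsmooth_real_diff dsmooth_real_mult F h dsmooth_real_const)
    show "F y - M * h y = f y" if "y \<in> cube_bdry n" for y
      using that F_bdry cube_bump_bdry by (simp add: h_def)
    show "F z - M * h z = 2" if "z \<in> V"
      using that cube_bump_pos[OF z] by (simp add: F_def h_def d_def)
  qed (use M in blast)
qed

lemma cube_interior_point: "\<exists>z. z \<in> cube n \<and> z \<notin> cube_bdry n"
  by (rule exI[of _ "\<lambda>i. if i < n then 1 / 2 else 0"]) (auto simp: cube_def cube_bdry_def Rn_def)

section \<open>Gluing along colimits and pushouts\<close>

text \<open>Two points agree in the colimit only if a zigzag of transition maps joins them, and
  \<open>compat\<close> keeps the value constant along each step. The choice in \<open>h\<close> is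
  thus independent of the representative.\<close>

lemma diff_colimit_glue:
  assumes Y: "diff_colimit A Z Zm Y g"
    and compat: "\<And>a c x. a \<in> A \<Longrightarrow> c \<in> A \<Longrightarrow> a \<le> c \<Longrightarrow> x \<in> dcarrier (Z a) \<Longrightarrow> f c (Zm a c x) = f a x"
  obtains h where "\<And>a x. a \<in> A \<Longrightarrow> x \<in> dcarrier (Z a) \<Longrightarrow> h (g a x) = f a x"
proof -
  define R where "R = {((a, x), (c, Zm a c x)) | a c x. a \<in> A \<and> c \<in> A \<and> a \<le> c \<and> x \<in> dcarrier (Z a)}"
  have eq: "f a x = f b y"
    if "a \<in> A" "b \<in> A" "x \<in> dcarrier (Z a)" "y \<in> dcarrier (Z b)" "g a x = g b y" for a b x y
  proof -
    have "((a, x), (b, y)) \<in> (R \<union> R\<inverse>)\<^sup>*"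
      using Y that unfolding diff_colimit_def Let_def R_def[symmetric] by blast
    then show ?thesis
    proof (induction rule: rtrancl_induct2)
      case (step b y c z)
      then show ?case using compat by (auto simp: R_def)
    qed simp
  qed
  define h where "h v = (SOME r. \<exists>a\<in>A. \<exists>x\<in>dcarrier (Z a). g a x = v \<and> r = f a x)" for v
  have "h (g a x) = f a x" if "a \<in> A" "x \<in> dcarrier (Z a)" for a x
  proof -
    have "\<exists>b\<in>A. \<exists>y\<in>dcarrier (Z b). g b y = g a x \<and> h (g a x) = f b y"
      unfolding h_def by (rule someI[of _ "f a x"]) (use that in blast)
    then show ?thesis using eq that by metis
  qed
  then show thesis using that by blast
qed

text \<open>A plot of the colimit is locally constant or locally lifts to a plot of some stage, and
  smoothness is local.\<close>

lemma dsmooth_real_colimit: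
  assumes Y: "diff_colimit A Z Zm Y g"
    and smooth: "\<And>a. a \<in> A \<Longrightarrow> dsmooth_real (Z a) (\<lambda>x. h (g a x))"
  shows "dsmooth_real Y h"
proof (rule dsmooth_realI)
  fix n U p assume "dplots Y n U p"
  then have U: "open_Rn n U" and loc: "\<And>r. r \<in> U \<Longrightarrow> \<exists>V. open_Rn n V \<and> r \<in> V \<and> V \<subseteq> U \<and>
      ((\<exists>y. \<forall>s\<in>V. p s = y) \<or> (\<exists>a\<in>A. \<exists>q. dplots (Z a) n V q \<and> (\<forall>s\<in>V. p s = g a (q s))))"
    using Y unfolding diff_colimit_def by blast+
  show "smooth_fun n U (\<lambda>x. h (p x))"
  proof (rule smooth_fun_local[OF U])
    fix r assume "r \<in> U"
    then obtain V where V: "open_Rn n V" "r \<in> V" "V \<subseteq> U" and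
      "(\<exists>y. \<forall>s\<in>V. p s = y) \<or> (\<exists>a\<in>A. \<exists>q. dplots (Z a) n V q \<and> (\<forall>s\<in>V. p s = g a (q s)))"
      using loc by blast
    then have "smooth_fun n V (\<lambda>x. h (p x))"
    proof (elim disjE exE bexE conjE)
      fix y assume "\<forall>s\<in>V. p s = y"
      then show ?thesis using smooth_fun_cong[OF V(1) smooth_fun_const[of n V "h y"]] by auto
    next
      fix a q assume "a \<in> A" "dplots (Z a) n V q" "\<forall>s\<in>V. p s = g a (q s)"
      then show ?thesis
        using smooth_fun_cong[OF V(1) dsmooth_real_plot[OF smooth]] by auto
    qed
    with V show "\<exists>V. open_Rn n V \<and> r \<in> V \<and> V \<subseteq> U \<and> smooth_fun n V (\<lambda>x. h (p x))" by blast
  qed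
qed

text \<open>The zigzag argument again, in the disjoint sum of \<open>Zb\<close> and the cube, with
  steps pairing a boundary point with its image under \<open>\<phi>\<close>.\<close>

lemma diff_pushout_glue:
  fixes Zb :: "'a diffsp"
  assumes P: "diff_pushout n \<phi> Zb P j chi"
    and \<phi>: "\<phi> ` cube_bdry n \<subseteq> dcarrier Zb"
    and compat: "\<And>y. y \<in> cube_bdry n \<Longrightarrow> F y = f (\<phi> y)"
  obtains h where "\<And>u. u \<in> dcarrier Zb \<Longrightarrow> h (j u) = f u" "\<And>y. y \<in> cube n \<Longrightarrow> h (chi y) = F y"
proof -
  define R :: "(('a + (nat \<Rightarrow> real)) \<times> ('a + (nat \<Rightarrow> real))) set"
    where "R = {(Inl (\<phi> x), Inr x) | x. x \<in> cube_bdry n}"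
  have eq: "case_sum f F u = case_sum f F v"
    if "u \<in> dcarrier Zb <+> cube n" "v \<in> dcarrier Zb <+> cube n"
      "case_sum j chi u = case_sum j chi v" for u v
  proof -
    have "(u, v) \<in> (R \<union> R\<inverse>)\<^sup>*"
      using P that unfolding diff_pushout_def Let_def R_def[symmetric] by blast
    then show ?thesis
    proof induction
      case (step v w)
      then show ?case using compat by (auto simp: R_def)
    qed simp
  qed
  define h where "h v = (SOME r. \<exists>u\<in>dcarrier Zb <+> cube n. case_sum j chi u = v \<and> r = case_sum f F u)" for v
  have h: "h (case_sum j chi u) = case_sum f F u" if "u \<in> dcarrier Zb <+> cube n" for u
  proof -
    have "\<exists>w\<in>dcarrier Zb <+> cube n.
        case_sum j chi w = case_sum j chi u \<and> h (case_sum j chi u) = case_sum f F w"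
      unfolding h_def by (rule someI[of _ "case_sum f F u"]) (use that in blast)
    then show ?thesis using eq that by metis
  qed
  show thesis
    using that[of h] h[OF InlI] h[OF InrI] by simp
qed

lemma dsmooth_real_pushout:
  assumes P: "diff_pushout n \<phi> Zb P j chi"
    and smooth: "dsmooth_real Zb (\<lambda>u. h (j u))" "dsmooth_real (Icube n) (\<lambda>y. h (chi y))"
  shows "dsmooth_real P h"
proof (rule dsmooth_realI)
  fix m U p assume "dplots P m U p"
  then have U: "open_Rn m U" and loc: "\<And>r. r \<in> U \<Longrightarrow> \<exists>V. open_Rn m V \<and> r \<in> V \<and> V \<subseteq> U \<and>
      ((\<exists>y. \<forall>s\<in>V. p s = y) \<or> (\<exists>q. dplots Zb m V q \<and> (\<forall>s\<in>V. p s = j (q s))) \<or>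
       (\<exists>q. dplots (Icube n) m V q \<and> (\<forall>s\<in>V. p s = chi (q s))))"
    using P unfolding diff_pushout_def by blast+
  show "smooth_fun m U (\<lambda>x. h (p x))"
  proof (rule smooth_fun_local[OF U])
    fix r assume "r \<in> U"
    then obtain V where V: "open_Rn m V" "r \<in> V" "V \<subseteq> U" and
      "(\<exists>y. \<forall>s\<in>V. p s = y) \<or> (\<exists>q. dplots Zb m V q \<and> (\<forall>s\<in>V. p s = j (q s))) \<or>
       (\<exists>q. dplots (Icube n) m V q \<and> (\<forall>s\<in>V. p s = chi (q s)))"
      using loc by blast
    then have "smooth_fun m V (\<lambda>x. h (p x))"
    proof (elim disjE exE conjE)
      fix y assume "\<forall>s\<in>V. p s = y"
      then show ?thesis using smooth_fun_cong[OF V(1) smooth_fun_const[of m V "h y"]] by auto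
    next
      fix q assume "dplots Zb m V q" "\<forall>s\<in>V. p s = j (q s)"
      then show ?thesis
        using smooth_fun_cong[OF V(1) dsmooth_real_plot[OF smooth(1)]] by auto
    next
      fix q assume "dplots (Icube n) m V q" "\<forall>s\<in>V. p s = chi (q s)"
      then show ?thesis
        using smooth_fun_cong[OF V(1) dsmooth_real_plot[OF smooth(2)]] by auto
    qed
    with V show "\<exists>V. open_Rn m V \<and> r \<in> V \<and> V \<subseteq> U \<and> smooth_fun m V (\<lambda>x. h (p x))" by blast
  qed
qed

section \<open>Pullbacks, kinds of stages and the Lindelof property\<close>

lemma dsmooth_carrier: "dsmooth X Y f \<Longrightarrow> x \<in> dcarrier X \<Longrightarrow> f x \<in> dcarrier Y"
  by (auto simp: dsmooth_def)

lemma dsmooth_compose: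
  assumes "dsmooth X Y f" "dsmooth Y W g"
  shows "dsmooth X W (\<lambda>x. g (f x))"
  using assms unfolding dsmooth_def by (fastforce simp: comp_def)

lemma D_open_cube_param:
  assumes "dsmooth (Icube n) X f" "D_open X V"
  shows "open_Rn n {x \<in> Rn n. cube_param x \<in> {y. f y \<in> V}}"
proof -
  have "dplots X n (Rn n) (f \<circ> cube_param)"
    using assms(1) dplots_cube_param by (simp add: dsmooth_def)
  then have "open_Rn n {r \<in> Rn n. (f \<circ> cube_param) r \<in> V}"
    using assms(2) unfolding D_open_def by blast
  then show ?thesis by simp
qed

lemma diffeology_plotD:
  assumes "diffeology X" "dplots X n U p"
  shows "open_Rn n U" "p ` U \<subseteq> dcarrier X"
  using assms unfolding diffeology_def by (metis (no_types))+

lemma diff_colimit_carrier: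
  "diff_colimit A Z Zm Y g \<Longrightarrow> dcarrier Y = (\<Union>a\<in>A. g a ` dcarrier (Z a))"
  unfolding diff_colimit_def by (elim conjE)

text \<open>If \<open>a\<close> is neither least nor a limit, some \<open>b < a\<close> has nothing
  strictly between itself and \<open>a\<close>; it is then the greatest element below
  \<open>a\<close>.\<close>

lemma wellorder_cases:
  fixes a :: "'i::wellorder"
  obtains (least) "a = (LEAST a. True)" | (limit) "is_limit_ord a"
    | (succ) b where "b < a" "a = ord_succ b" "\<And>c. c < a \<Longrightarrow> c \<le> b"
proof -
  consider "a = (LEAST a. True)" | "is_limit_ord a" | b where "b < a" "\<And>c. b < c \<Longrightarrow> \<not> c < a"
    unfolding is_limit_ord_def by blast
  then show thesis
  proof cases
    case 3
    then have "a = ord_succ b" unfolding ord_succ_def 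
      by (intro Least_equality[symmetric]) (auto simp: not_less)
    moreover have "c \<le> b" if "c < a" for c using 3(2) that not_le by blast
    ultimately show thesis using succ 3(1) by blast
  qed (use least limit in blast)+
qed

lemma dsmooth_real_cong:
  assumes "diffeology X" "dsmooth_real X f" "\<And>x. x \<in> dcarrier X \<Longrightarrow> f x = g x"
  shows "dsmooth_real X g"
proof (rule dsmooth_realI)
  fix n U p assume p: "dplots X n U p"
  show "smooth_fun n U (\<lambda>x. g (p x))"
    using diffeology_plotD(2)[OF assms(1) p] assms(3)
    by (intro smooth_fun_cong[OF diffeology_plotD(1)[OF assms(1) p] dsmooth_real_plot[OF assms(2) p]]) auto
qed

text \<open>The preimages of the sets \<open>W x\<close> are open in \<open>Rn n\<close>, which is
  second countable, so countably many of them have the same union as all.\<close>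

lemma plot_image_Lindelof:
  assumes p: "dplots X n U p" and U: "open_Rn n U"
    and W: "\<And>x. x \<in> p ` U \<Longrightarrow> D_open X (W x)" "\<And>x. x \<in> p ` U \<Longrightarrow> x \<in> W x"
  obtains C where "countable C" "C \<subseteq> p ` U" "p ` U \<subseteq> (\<Union>x\<in>C. W x)"
proof -
  define A where "A x = {r \<in> U. p r \<in> W x}" for x
  have "openin (top_of_set (Rn n)) S" if "S \<in> A ` p ` U" for S
    using that W(1) p unfolding A_def D_open_def open_Rn_def by blast
  then obtain F where F: "F \<subseteq> A ` p ` U" "countable F" "\<Union>F = \<Union>(A ` p ` U)"
    using Lindelof_openin by metis
  then obtain C where C: "countable C" "C \<subseteq> p ` U" "F = A ` C"
    by (metis countable_subset_image)
  have "p r \<in> (\<Union>x\<in>C. W x)" if "r \<in> U" for r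
  proof -
    have "r \<in> A (p r)" using that W(2) by (auto simp: A_def)
    then have "r \<in> \<Union>F" using F(3) that by blast
    then show ?thesis using C(3) by (auto simp: A_def)
  qed
  with C(1,2) show thesis using that by blast
qed

section \<open>Separating functions on cell complexes\<close>

locale cell_complex =
  fixes X :: "'x diffsp" and Z :: "'i::wellorder \<Rightarrow> 'a diffsp" and Zm :: "'i \<Rightarrow> 'i \<Rightarrow> 'a \<Rightarrow> 'a"
    and inc :: "'i \<Rightarrow> 'a \<Rightarrow> 'x"
  assumes delta: "delta_sequence Z Zm"
    and empty: "dcarrier (Z (LEAST a. True)) = {}"
    and colim: "diff_colimit UNIV Z Zm X inc"
    and attach: "b < c \<Longrightarrow> \<exists>n \<phi> chi. dsmooth (dIcube n) (Z b) \<phi> \<and>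
      diff_pushout n \<phi> (Z b) (Z (ord_succ b)) (Zm b (ord_succ b)) chi"
begin

lemma diffeology_X: "diffeology X"
  using colim by (simp add: diff_colimit_def)

lemma diffeology_Z: "diffeology (Z a)"
  using delta by (simp add: delta_sequence_def)

lemma dsmooth_Zm: "a \<le> b \<Longrightarrow> dsmooth (Z a) (Z b) (Zm a b)"
  using delta by (simp add: delta_sequence_def)

lemma Zm_Zm: "a \<le> b \<Longrightarrow> b \<le> c \<Longrightarrow> x \<in> dcarrier (Z a) \<Longrightarrow> Zm b c (Zm a b x) = Zm a c x"
  using delta unfolding delta_sequence_def by blast

lemma limit_colimit: "is_limit_ord b \<Longrightarrow> diff_colimit {a. a < b} Z Zm (Z b) (\<lambda>a. Zm a b)"
  using delta by (simp add: delta_sequence_def)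

lemma dsmooth_inc: "dsmooth (Z a) X (inc a)"
  using colim by (simp add: diff_colimit_def)

lemma inc_Zm: "a \<le> c \<Longrightarrow> x \<in> dcarrier (Z a) \<Longrightarrow> inc c (Zm a c x) = inc a x"
  using colim by (simp add: diff_colimit_def)

lemma carrier_X: "dcarrier X = (\<Union>a. inc a ` dcarrier (Z a))"
  by (rule diff_colimit_carrier[OF colim])

text \<open>Every point lies in the interior of some cell: take the first stage at which it appears.\<close>

lemma first_stage:
  assumes "x \<in> dcarrier X"
  obtains b u where "b < ord_succ b" "u \<in> dcarrier (Z (ord_succ b))" "inc (ord_succ b) u = x"
    "\<And>c. c < ord_succ b \<Longrightarrow> u \<notin> Zm c (ord_succ b) ` dcarrier (Z c)"
proof -
  define a where "a = (LEAST a. x \<in> inc a ` dcarrier (Z a))"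
  have ex: "x \<in> inc a ` dcarrier (Z a)"
    unfolding a_def by (rule LeastI_ex) (use assms carrier_X in auto)
  have min: "x \<notin> inc c ` dcarrier (Z c)" if "c < a" for c
    using not_less_Least[of c "\<lambda>a. x \<in> inc a ` dcarrier (Z a)"] that by (simp add: a_def)
  obtain u where u: "u \<in> dcarrier (Z a)" "inc a u = x" using ex by auto
  have notin: "u \<notin> Zm c a ` dcarrier (Z c)" if c: "c < a" for c
  proof
    assume "u \<in> Zm c a ` dcarrier (Z c)"
    then obtain v where "v \<in> dcarrier (Z c)" "u = Zm c a v" by blast
    then have "x = inc c v" using inc_Zm[of c a v] c u(2) by simp
    then show False using min[OF c] \<open>v \<in> dcarrier (Z c)\<close> by blast
  qed
  show thesis
  proof (cases a rule: wellorder_cases)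
    case least
    then show thesis using u(1) empty by auto
  next
    case limit
    \<comment> \<open>A point of a limit stage comes from an earlier one, against
      minimality.\<close>
    then show thesis using diff_colimit_carrier[OF limit_colimit] u(1) notin by auto
  next
    case (succ b)
    then show thesis using that[of b u] u notin by simp
  qed
qed

section \<open>Transfinite construction of a separating function\<close>

text \<open>The new function is glued from \<open>f\<close> on the old stage and an extension over
  the attached cube. The point \<open>u0\<close> receives the value 2 if it is new at this stage and
  lies over \<open>V\<close>.\<close>

lemma extend_succ:
  assumes "b < c" and V: "D_open X V"
    and f: "dsmooth_real (Z b) f" "\<And>u. u \<in> dcarrier (Z b) \<Longrightarrow> inc b u \<notin> V \<Longrightarrow> f u < 1"
  obtains h where "dsmooth_real (Z (ord_succ b)) h"
    "\<And>u. u \<in> dcarrier (Z b) \<Longrightarrow> h (Zm b (ord_succ b) u) = f u"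
    "\<And>u. u \<in> dcarrier (Z (ord_succ b)) \<Longrightarrow> inc (ord_succ b) u \<notin> V \<Longrightarrow> h u < 1"
    "u0 \<in> dcarrier (Z (ord_succ b)) \<Longrightarrow> u0 \<notin> Zm b (ord_succ b) ` dcarrier (Z b) \<Longrightarrow>
      inc (ord_succ b) u0 \<in> V \<Longrightarrow> h u0 = 2"
proof -
  let ?s = "ord_succ b"
  have "b \<le> ?s" using LeastI[of "\<lambda>c. b < c" c] \<open>b < c\<close> unfolding ord_succ_def by simp
  obtain n \<phi> chi where \<phi>: "dsmooth (dIcube n) (Z b) \<phi>" and
    push: "diff_pushout n \<phi> (Z b) (Z ?s) (Zm b ?s) chi"
    using attach[OF \<open>b < c\<close>] by blast
  have carrier: "dcarrier (Z ?s) = Zm b ?s ` dcarrier (Z b) \<union> chi ` cube n"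
    and chi: "dsmooth (Icube n) (Z ?s) chi"
    and chi_bdry: "\<And>y. y \<in> cube_bdry n \<Longrightarrow> Zm b ?s (\<phi> y) = chi y"
    using push unfolding diff_pushout_def by auto
  have \<phi>_carrier: "\<phi> y \<in> dcarrier (Z b)" if "y \<in> cube_bdry n" for y
    using dsmooth_carrier[OF \<phi>] that by (simp add: dIcube_def subspace_def)
  define V' where "V' = {y. inc ?s (chi y) \<in> V}"
  have V': "open_Rn n {x \<in> Rn n. cube_param x \<in> V'}"
    unfolding V'_def by (rule D_open_cube_param[OF dsmooth_compose[OF chi dsmooth_inc] V])
  \<comment> \<open>A new point comes from a cube point \<open>z\<close>, which is interior because
    the boundary is glued to the old stage. In the other case any interior point serves.\<close>
  have "\<exists>z. z \<in> cube n \<and> z \<notin> cube_bdry n \<and> (u0 \<in> dcarrier (Z ?s) - Zm b ?s ` dcarrier (Z b) \<longrightarrow> u0 = chi z)"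
  proof (cases "u0 \<in> dcarrier (Z ?s) - Zm b ?s ` dcarrier (Z b)")
    case True
    then obtain z where "z \<in> cube n" "u0 = chi z" using carrier by blast
    moreover from this have "z \<notin> cube_bdry n" using True chi_bdry \<phi>_carrier by (metis DiffD2 imageI)
    ultimately show ?thesis by blast
  qed (use cube_interior_point in blast)
  then obtain z where z: "z \<in> cube n" "z \<notin> cube_bdry n"
    "u0 \<in> dcarrier (Z ?s) - Zm b ?s ` dcarrier (Z b) \<Longrightarrow> u0 = chi z" by blast
  have below: "f (\<phi> y) < 1" if "y \<in> cube_bdry n" "y \<notin> V'" for y
    using that f(2)[OF \<phi>_carrier] inc_Zm[OF \<open>b \<le> ?s\<close> \<phi>_carrier] chi_bdry by (auto simp: V'_def)
  obtain F where F: "dsmooth_real (Icube n) F" "\<And>y. y \<in> cube_bdry n \<Longrightarrow> F y = f (\<phi> y)"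
    "\<And>y. y \<in> cube n \<Longrightarrow> y \<notin> V' \<Longrightarrow> F y < 1" "z \<in> V' \<Longrightarrow> F z = 2"
    using cell_extend[OF dsmooth_dsmooth_real[OF \<phi> f(1)] below V' z(1,2)] by blast
  obtain h where h: "\<And>u. u \<in> dcarrier (Z b) \<Longrightarrow> h (Zm b ?s u) = f u"
    "\<And>y. y \<in> cube n \<Longrightarrow> h (chi y) = F y"
    by (rule diff_pushout_glue[where F = F and f = f, OF push]) (use F(2) \<phi>_carrier in auto)
  show thesis
  proof
    show "dsmooth_real (Z ?s) h"
    proof (rule dsmooth_real_pushout[OF push])
      show "dsmooth_real (Z b) (\<lambda>u. h (Zm b ?s u))"
        using dsmooth_real_cong[OF diffeology_Z f(1)] h(1) by simp
      show "dsmooth_real (Icube n) (\<lambda>y. h (chi y))"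
      proof (rule dsmooth_realI)
        fix m U p assume p: "dplots (Icube n) m U p"
        then show "smooth_fun m U (\<lambda>x. h (chi (p x)))"
          by (intro smooth_fun_cong[OF _ dsmooth_real_plot[OF F(1) p]])
            (use h(2) in \<open>auto simp: dplots_Icube\<close>)
      qed
    qed
    show "h u < 1" if "u \<in> dcarrier (Z ?s)" "inc ?s u \<notin> V" for u
      using that carrier h f(2) F(3) inc_Zm[OF \<open>b \<le> ?s\<close>] by (auto simp: V'_def)
    show "h u0 = 2"
      if "u0 \<in> dcarrier (Z ?s)" "u0 \<notin> Zm b ?s ` dcarrier (Z b)" "inc ?s u0 \<in> V"
      using z that h(2) F(4) by (simp add: V'_def)
  qed (use h in blast)
qed

text \<open>The value 2 is prescribed at the first stage containing \<open>x\<close>, where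
  \<open>x\<close> comes from the interior of a cell. Compatibility of all later functions preserves
  it in the colimit.\<close>

lemma separating_function:
  assumes V: "D_open X V" and x: "x \<in> V"
  obtains h where "dsmooth_real X h" "\<And>y. y \<in> dcarrier X \<Longrightarrow> y \<notin> V \<Longrightarrow> h y < 1" "h x = 2"
proof -
  have "x \<in> dcarrier X" using V x by (auto simp: D_open_def)
  then obtain b u where b: "b < ord_succ b" and u: "u \<in> dcarrier (Z (ord_succ b))"
    "inc (ord_succ b) u = x"
    "\<And>c. c < ord_succ b \<Longrightarrow> u \<notin> Zm c (ord_succ b) ` dcarrier (Z c)"
    using first_stage by metis
  \<comment> \<open>\<open>r\<close> is admissible at stage \<open>a\<close> if it is below 1 off
    \<open>V\<close>, compatible with \<open>f\<close> at all earlier stages, and correct at the one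
    prescribed stage. \<open>P\<close> reads \<open>f\<close> only below \<open>a\<close>, as the
    recursion demands.\<close>
  define P where "P f a r \<longleftrightarrow> dsmooth_real (Z a) r \<and>
      (\<forall>v\<in>dcarrier (Z a). inc a v \<notin> V \<longrightarrow> r v < 1) \<and>
      (\<forall>c<a. \<forall>v\<in>dcarrier (Z c). r (Zm c a v) = f c v) \<and>
      (a = ord_succ b \<longrightarrow> r u = 2)" for f :: "'i \<Rightarrow> 'a \<Rightarrow> real" and a r
  have "\<exists>f. \<forall>a. P f a (f a)"
  proof (rule dependent_wellorder_choice)
    fix r :: "'a \<Rightarrow> real" and f g :: "'i \<Rightarrow> 'a \<Rightarrow> real" and a
    assume "\<And>c. c < a \<Longrightarrow> f c = g c"
    then show "P f a r = P g a r" by (simp add: P_def)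
  next
    fix a and f :: "'i \<Rightarrow> 'a \<Rightarrow> real"
    assume IH: "\<And>c. c < a \<Longrightarrow> P f c (f c)"
    show "\<exists>r. P f a r"
    proof (cases a rule: wellorder_cases)
      case least
      then have "\<not> c < a" for c using not_less_Least[of c "\<lambda>_. True"] by blast
      moreover have "dcarrier (Z a) = {}" using least empty by simp
      \<comment> \<open>The constant 2 satisfies the last clause of \<open>P\<close> at any stage;
        the other clauses are vacuous here.\<close>
      ultimately have "P f a (\<lambda>_. 2)" by (simp add: P_def)
      then show ?thesis by blast
    next
      case limit
      have Zm_refl: "Zm c c v = v" if "v \<in> dcarrier (Z c)" for c v
        using that delta by (simp add: delta_sequence_def)
      have "f d (Zm c d v) = f c v" if "c < a" "d < a" "c \<le> d" "v \<in> dcarrier (Z c)" for c d v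
        using IH[OF \<open>d < a\<close>] that Zm_refl[OF that(4)] by (cases "c = d") (auto simp: P_def)
      then obtain h where h: "\<And>c v. c < a \<Longrightarrow> v \<in> dcarrier (Z c) \<Longrightarrow> h (Zm c a v) = f c v"
        by (rule diff_colimit_glue[OF limit_colimit[OF limit], of f]) auto
      have "dsmooth_real (Z a) h"
      proof (rule dsmooth_real_colimit[OF limit_colimit[OF limit]])
        fix c assume "c \<in> {c. c < a}"
        then have c: "c < a" by simp
        then have "dsmooth_real (Z c) (f c)" using IH by (simp add: P_def)
        then show "dsmooth_real (Z c) (\<lambda>v. h (Zm c a v))"
          by (rule dsmooth_real_cong[OF diffeology_Z]) (simp add: h c)
      qed
      moreover have "h v < 1" if v: "v \<in> dcarrier (Z a)" "inc a v \<notin> V" for v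
      proof -
        obtain c v' where v': "c < a" "v' \<in> dcarrier (Z c)" "v = Zm c a v'"
          using diff_colimit_carrier[OF limit_colimit[OF limit]] v(1) by auto
        then have "inc c v' \<notin> V" using inc_Zm[of c a v'] v(2) by simp
        then show ?thesis using v' h[of c v'] IH[OF \<open>c < a\<close>] by (simp add: P_def)
      qed
      \<comment> \<open>The prescribed stage is a successor, so a limit stage has no value to
        meet.\<close>
      moreover have "a \<noteq> ord_succ b"
      proof
        assume "a = ord_succ b"
        then obtain c where "b < c" "c < ord_succ b"
          using limit b unfolding is_limit_ord_def by blast
        then show False using not_less_Least[of c "\<lambda>c. b < c"] by (simp add: ord_succ_def)
      qed
      ultimately have "P f a h" using h by (simp add: P_def)
      then show ?thesis by blast
    next
      case (succ d)
      have fd: "dsmooth_real (Z d) (f d)"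
        "\<And>v. v \<in> dcarrier (Z d) \<Longrightarrow> inc d v \<notin> V \<Longrightarrow> f d v < 1"
        "\<And>c v. c < d \<Longrightarrow> v \<in> dcarrier (Z c) \<Longrightarrow> f d (Zm c d v) = f c v"
        using IH[OF \<open>d < a\<close>] by (auto simp: P_def)
      obtain h where h: "dsmooth_real (Z a) h"
        "\<And>v. v \<in> dcarrier (Z d) \<Longrightarrow> h (Zm d a v) = f d v"
        "\<And>v. v \<in> dcarrier (Z a) \<Longrightarrow> inc a v \<notin> V \<Longrightarrow> h v < 1"
        "u \<in> dcarrier (Z a) \<Longrightarrow> u \<notin> Zm d a ` dcarrier (Z d) \<Longrightarrow> inc a u \<in> V \<Longrightarrow> h u = 2"
        using extend_succ[OF \<open>d < a\<close> V fd(1,2), of u] unfolding succ(2)[symmetric] by blast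
      have "h (Zm c a v) = f c v" if c: "c < a" and v: "v \<in> dcarrier (Z c)" for c v
      proof (cases "c = d")
        case True
        then show ?thesis using h(2) v by simp
      next
        case False
        then have "c < d" using succ(3)[OF c] by simp
        then have "h (Zm c a v) = h (Zm d a (Zm c d v))"
          using Zm_Zm[of c d a v] succ(1) v by simp
        also have "\<dots> = f c v"
          using h(2)[OF dsmooth_carrier[OF dsmooth_Zm v]] fd(3)[OF \<open>c < d\<close> v] \<open>c < d\<close> by simp
        finally show ?thesis .
      qed
      moreover have "h u = 2" if "a = ord_succ b"
        using h(4) u(1,2) u(3)[of d] that succ(1) x by simp
      ultimately have "P f a h" using h(1,3) by (simp add: P_def)
      then show ?thesis by blast
    qed
  qed
  then obtain f where f: "\<And>a. P f a (f a)" by blast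
  have f_compat: "f c (Zm a c v) = f a v" if "a \<le> c" "v \<in> dcarrier (Z a)" for a c v
  proof (cases "a = c")
    case True
    then show ?thesis using delta that by (simp add: delta_sequence_def)
  next
    case False
    then show ?thesis using f[of c] that by (simp add: P_def)
  qed
  obtain h where h: "\<And>a v. v \<in> dcarrier (Z a) \<Longrightarrow> h (inc a v) = f a v"
    by (rule diff_colimit_glue[OF colim, of f]) (use f_compat in auto)
  show thesis
  proof
    show "dsmooth_real X h"
    proof (rule dsmooth_real_colimit[OF colim])
      fix a
      have "dsmooth_real (Z a) (f a)" using f[of a] by (simp add: P_def)
      then show "dsmooth_real (Z a) (\<lambda>v. h (inc a v))"
        by (rule dsmooth_real_cong[OF diffeology_Z]) (simp add: h)
    qed
    show "h y < 1" if y: "y \<in> dcarrier X" "y \<notin> V" for y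
    proof -
      obtain a v where "v \<in> dcarrier (Z a)" "y = inc a v" using y(1) carrier_X by auto
      then show ?thesis using f[of a] y(2) by (simp add: h P_def)
    qed
    show "h x = 2" using h[OF u(1)] f[of "ord_succ b"] u(2) by (simp add: P_def)
  qed
qed

section \<open>Countable subcovers\<close>

text \<open>Each cell lies in the image of a plot and is covered by countably many
  \<open>W x\<close>. Every point is new at some successor stage, and there are countably many
  stages.\<close>

lemma countable_subcover:
  assumes countable: "countable (UNIV :: 'i set)"
    and W: "\<And>x. x \<in> dcarrier X \<Longrightarrow> D_open X (W x)" "\<And>x. x \<in> dcarrier X \<Longrightarrow> x \<in> W x"
  obtains C where "countable C" "C \<subseteq> dcarrier X" "dcarrier X \<subseteq> (\<Union>x\<in>C. W x)"
proof -
  \<comment> \<open>\<open>b < ord_succ b\<close> says that \<open>b\<close> has a successor; at a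
    last stage \<open>ord_succ b\<close> is a \<open>LEAST\<close> without a witness.\<close>
  have "\<exists>C. countable C \<and> C \<subseteq> dcarrier X \<and>
      (\<forall>u\<in>dcarrier (Z (ord_succ b)) - Zm b (ord_succ b) ` dcarrier (Z b).
        inc (ord_succ b) u \<in> (\<Union>x\<in>C. W x))" if b: "b < ord_succ b" for b
  proof -
    obtain n \<phi> chi where push: "diff_pushout n \<phi> (Z b) (Z (ord_succ b)) (Zm b (ord_succ b)) chi"
      using attach[OF b] by blast
    then have carrier: "dcarrier (Z (ord_succ b)) = Zm b (ord_succ b) ` dcarrier (Z b) \<union> chi ` cube n"
      and chi: "dsmooth (Icube n) (Z (ord_succ b)) chi"
      unfolding diff_pushout_def by auto
    let ?p = "\<lambda>r. inc (ord_succ b) (chi (cube_param r))"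
    have p: "dplots X n (Rn n) ?p"
      using dsmooth_compose[OF chi dsmooth_inc] dplots_cube_param
      by (auto simp: dsmooth_def comp_def)
    have sub: "?p ` Rn n \<subseteq> dcarrier X"
      by (rule diffeology_plotD(2)[OF diffeology_X p])
    have W_p: "D_open X (W x)" "x \<in> W x" if "x \<in> ?p ` Rn n" for x
      using W sub that by auto
    obtain C where C: "countable C" "C \<subseteq> ?p ` Rn n" "?p ` Rn n \<subseteq> (\<Union>x\<in>C. W x)"
      by (rule plot_image_Lindelof[OF p open_Rn_Rn W_p])
    have "inc (ord_succ b) u \<in> (\<Union>x\<in>C. W x)"
      if u: "u \<in> dcarrier (Z (ord_succ b)) - Zm b (ord_succ b) ` dcarrier (Z b)" for u
    proof -
      obtain y where "y \<in> cube n" "u = chi y" using u carrier by blast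
      moreover from this obtain r where "r \<in> Rn n" "y = cube_param r" using cube_param_surj by blast
      ultimately show ?thesis using C(3) by blast
    qed
    moreover have "C \<subseteq> dcarrier X" using C(2) sub by (rule order_trans)
    ultimately show ?thesis using C(1) by blast
  qed
  then obtain C where C: "\<And>b. b < ord_succ b \<Longrightarrow> countable (C b)"
    "\<And>b. b < ord_succ b \<Longrightarrow> C b \<subseteq> dcarrier X"
    "\<And>b u. b < ord_succ b \<Longrightarrow> u \<in> dcarrier (Z (ord_succ b)) - Zm b (ord_succ b) ` dcarrier (Z b) \<Longrightarrow>
        inc (ord_succ b) u \<in> (\<Union>x\<in>C b. W x)"
    by metis
  show thesis
  proof
    show "countable (\<Union>b\<in>{b. b < ord_succ b}. C b)"
      using C(1) countable_subset[OF subset_UNIV countable] by (intro countable_UN) auto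
    show "(\<Union>b\<in>{b. b < ord_succ b}. C b) \<subseteq> dcarrier X" using C(2) by blast
    show "dcarrier X \<subseteq> (\<Union>x\<in>(\<Union>b\<in>{b. b < ord_succ b}. C b). W x)"
    proof
      fix x assume "x \<in> dcarrier X"
      then obtain b u where b: "b < ord_succ b" and u: "u \<in> dcarrier (Z (ord_succ b))"
        "inc (ord_succ b) u = x"
        "\<And>c. c < ord_succ b \<Longrightarrow> u \<notin> Zm c (ord_succ b) ` dcarrier (Z c)"
        using first_stage by metis
      then have "x \<in> (\<Union>x\<in>C b. W x)" using C(3)[OF b, of u] u(3)[OF b] by blast
      then show "x \<in> (\<Union>x\<in>(\<Union>b\<in>{b. b < ord_succ b}. C b). W x)" using b by blast
    qed
  qed
qed

end

section \<open>From separating functions to partitions of unity\<close>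

lemma D_open_empty: "D_open X {}"
  by (simp add: D_open_def open_Rn_def)

lemma D_open_Int: "D_open X A \<Longrightarrow> D_open X B \<Longrightarrow> D_open X (A \<inter> B)"
  unfolding D_open_def open_Rn_def
proof (intro conjI allI impI)
  fix n U p
  assume *: "A \<subseteq> dcarrier X \<and> (\<forall>n U p. dplots X n U p \<longrightarrow> openin (top_of_set (Rn n)) {r \<in> U. p r \<in> A})"
    "B \<subseteq> dcarrier X \<and> (\<forall>n U p. dplots X n U p \<longrightarrow> openin (top_of_set (Rn n)) {r \<in> U. p r \<in> B})"
    and p: "dplots X n U p"
  have "{r \<in> U. p r \<in> A \<inter> B} = {r \<in> U. p r \<in> A} \<inter> {r \<in> U. p r \<in> B}" by blast
  then show "openin (top_of_set (Rn n)) {r \<in> U. p r \<in> A \<inter> B}"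
    using * p by (auto intro: openin_Int)
qed auto

lemma D_open_Int_INT:
  "finite K \<Longrightarrow> D_open X A \<Longrightarrow> (\<And>k. k \<in> K \<Longrightarrow> D_open X (B k)) \<Longrightarrow> D_open X (A \<inter> (\<Inter>k\<in>K. B k))"
proof (induction K rule: finite_induct)
  case (insert k K)
  have "A \<inter> (\<Inter>k\<in>insert k K. B k) = (A \<inter> (\<Inter>k\<in>K. B k)) \<inter> B k" by blast
  then show ?case using insert by (auto intro: D_open_Int)
qed simp

lemma D_open_vimage:
  assumes X: "diffeology X" and f: "dsmooth_real X f" and T: "open T"
  shows "D_open X {x \<in> dcarrier X. f x \<in> T}"
  unfolding D_open_def
proof (intro conjI allI impI)
  fix n U p assume p: "dplots X n U p"
  note U = diffeology_plotD[OF X p]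
  have "openin (top_of_set U) (U \<inter> (\<lambda>r. f (p r)) -` T)"
    using smooth_fun_continuous[OF dsmooth_real_plot[OF f p]] T by (rule continuous_openin_preimage_gen)
  moreover have "{r \<in> U. p r \<in> {x \<in> dcarrier X. f x \<in> T}} = U \<inter> (\<lambda>r. f (p r)) -` T"
    using U(2) by auto
  ultimately show "open_Rn n {r \<in> U. p r \<in> {x \<in> dcarrier X. f x \<in> T}}"
    using U(1) openin_trans unfolding open_Rn_def by metis
qed auto

lemma dsmooth_real_local:
  assumes X: "diffeology X"
    and loc: "\<And>x. x \<in> dcarrier X \<Longrightarrow>
      \<exists>W g. D_open X W \<and> x \<in> W \<and> dsmooth_real X g \<and> (\<forall>y\<in>W. f y = g y)"
  shows "dsmooth_real X f"
proof (rule dsmooth_realI)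
  fix n U p assume p: "dplots X n U p"
  note U = diffeology_plotD[OF X p]
  show "smooth_fun n U (\<lambda>r. f (p r))"
  proof (rule smooth_fun_local[OF U(1)])
    fix r assume r: "r \<in> U"
    then have "p r \<in> dcarrier X" using U(2) by auto
    from loc[OF this] obtain W g
      where W: "D_open X W" "p r \<in> W" and g: "dsmooth_real X g" "\<forall>y\<in>W. f y = g y"
      by blast
    define V where "V = {r \<in> U. p r \<in> W}"
    have V: "open_Rn n V" using W(1) p unfolding D_open_def V_def by blast
    have "smooth_fun n V (\<lambda>r. g (p r))"
      using smooth_fun_subset[OF dsmooth_real_plot[OF g(1) p]] by (auto simp: V_def)
    then have "smooth_fun n V (\<lambda>r. f (p r))"
      by (rule smooth_fun_cong[OF V]) (use g(2) in \<open>auto simp: V_def\<close>)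
    then show "\<exists>V. open_Rn n V \<and> r \<in> V \<and> V \<subseteq> U \<and> smooth_fun n V (\<lambda>r. f (p r))"
      using V r W(2) by (intro exI[of _ V]) (auto simp: V_def)
  qed
qed

lemma dsmooth_real_inverse:
  assumes X: "diffeology X" and f: "dsmooth_real X f" and pos: "\<And>x. x \<in> dcarrier X \<Longrightarrow> 0 < f x"
  shows "dsmooth_real X (\<lambda>x. inverse (f x))"
proof (rule dsmooth_realI)
  fix n U p assume p: "dplots X n U p"
  then show "smooth_fun n U (\<lambda>x. inverse (f (p x)))"
    using diffeology_plotD(2)[OF X p] pos
    by (intro smooth_fun_comp[OF smooth_real_on_inverse dsmooth_real_plot[OF f p]]) auto
qed

lemma D_closure_disjoint:
  assumes "D_open X W" "S \<subseteq> dcarrier X" "S \<inter> W = {}"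
  shows "D_closure X S \<inter> W = {}"
proof -
  have "dcarrier X - (dcarrier X - W) = W" using assms(1) by (auto simp: D_open_def)
  then have "D_closure X S \<subseteq> dcarrier X - W"
    unfolding D_closure_def using assms by (intro Inter_lower) auto
  then show ?thesis by blast
qed

lemma D_closure_subset_carrier: "S \<subseteq> dcarrier X \<Longrightarrow> D_closure X S \<subseteq> dcarrier X"
  unfolding D_closure_def by (rule Inter_lower) (simp add: D_open_empty)

text \<open>With \<open>g k = flat (f k - 1)\<close>, damp \<open>g k\<close> by the factors \<open>flat (1 / (k + 1) - g j)\<close> for \<open>j < k\<close>.
  The products vanish near every point for large \<open>k\<close>, since some \<open>g j\<close> is bounded below there by a
  constant exceeding \<open>1 / (k + 1)\<close>; they have no common zero, since all factors are positive where
  \<open>k\<close> is the first index with \<open>g k > 0\<close>.\<close>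

lemma locally_finite_weights:
  fixes f :: "nat \<Rightarrow> 'x \<Rightarrow> real"
  assumes X: "diffeology X" and f: "\<And>k. dsmooth_real X (f k)"
    and cover: "\<And>x. x \<in> dcarrier X \<Longrightarrow> \<exists>k. 1 < f k x"
  obtains w :: "nat \<Rightarrow> 'x \<Rightarrow> real" where "\<And>k. dsmooth_real X (w k)" "\<And>k x. 0 \<le> w k x"
    "\<And>k x. f k x \<le> 1 \<Longrightarrow> w k x = 0"
    "\<And>x. x \<in> dcarrier X \<Longrightarrow> \<exists>k. 0 < w k x"
    "\<And>x. x \<in> dcarrier X \<Longrightarrow> \<exists>W N. D_open X W \<and> x \<in> W \<and> (\<forall>y\<in>W. \<forall>k\<ge>N. w k y = 0)"
proof -
  define g where "g k x = flat (f k x - 1)" for k x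
  define w where "w k x = g k x * (\<Prod>j<k. flat (inverse (Suc k) - g j x))" for k x
  have g: "dsmooth_real X (g k)" for k
    unfolding g_def by (intro dsmooth_real_flat dsmooth_real_diff f dsmooth_real_const)
  show thesis
  proof
    show "dsmooth_real X (w k)" for k
      unfolding w_def
      by (intro dsmooth_real_mult dsmooth_real_prod dsmooth_real_flat dsmooth_real_diff g dsmooth_real_const)
    show "0 \<le> w k x" for k x
      unfolding w_def by (intro mult_nonneg_nonneg prod_nonneg) (auto simp: g_def)
    show "w k x = 0" if "f k x \<le> 1" for k x
      using that by (simp add: w_def g_def flat_eq_0_iff)
    show "\<exists>k. 0 < w k x" if x: "x \<in> dcarrier X" for x
    proof -
      have ex: "\<exists>k. 0 < g k x" using cover[OF x] by (simp add: g_def flat_pos_iff)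
      define k where "k = (LEAST k. 0 < g k x)"
      have "0 < g k x" unfolding k_def using ex by (rule LeastI_ex)
      moreover have "g j x = 0" if "j < k" for j
        using not_less_Least[of j "\<lambda>k. 0 < g k x"] that 
        by (simp add: k_def g_def flat_pos_iff flat_eq_0_iff)
      ultimately have "0 < w k x"
        unfolding w_def by (intro mult_pos_pos prod_pos) (auto simp: flat_pos_iff)
      then show ?thesis ..
    qed
    show "\<exists>W N. D_open X W \<and> x \<in> W \<and> (\<forall>y\<in>W. \<forall>k\<ge>N. w k y = 0)" if x: "x \<in> dcarrier X" for x
    proof -
      obtain j where j: "0 < g j x" using cover[OF x] by (auto simp: g_def flat_pos_iff)
      obtain n where n: "inverse (real (Suc n)) < g j x / 2" using reals_Archimedean[of "g j x / 2"] j by auto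
      define W where "W = {y \<in> dcarrier X. g j y \<in> {g j x / 2<..}}"
      \<comment> \<open>\<open>k \<ge> n\<close> brings \<open>inverse (Suc k)\<close> below
        \<open>g j x / 2\<close>, and \<open>k \<ge> Suc j\<close> makes the factor of index
        \<open>j\<close> occur in the product.\<close>
      have "w k y = 0" if y: "y \<in> W" and k: "max n (Suc j) \<le> k" for y k
      proof -
        have "inverse (real (Suc k)) \<le> inverse (real (Suc n))" using k by (intro le_imp_inverse_le) auto
        moreover have "g j x / 2 < g j y" using y by (simp add: W_def)
        ultimately have "flat (inverse (Suc k) - g j y) = 0"
          unfolding flat_eq_0_iff using n by linarith
        moreover have "j \<in> {..<k}" using k by simp
        ultimately have "(\<Prod>j<k. flat (inverse (Suc k) - g j y)) = 0" by (metis finite_lessThan prod_zero)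
        then show ?thesis by (simp add: w_def)
      qed
      moreover have "D_open X W" unfolding W_def by (rule D_open_vimage[OF X g]) simp
      moreover have "x \<in> W" using x j by (simp add: W_def)
      ultimately show ?thesis by blast
    qed
  qed
qed

section \<open>Grouping and normalizing the weights\<close>

text \<open>Indices may share a label, so the weights are grouped by label and divided by their
  total. Near a point outside \<open>U l\<close> the finitely many relevant \<open>f k\<close> with
  label \<open>l\<close> are below 1, where their weights vanish; so even the closed supports lie in
  \<open>U l\<close>.\<close>

lemma partition_of_unity_if_separating_sequence:
  fixes f :: "nat \<Rightarrow> 'x \<Rightarrow> real"
  assumes X: "diffeology X" and f: "\<And>k. dsmooth_real X (f k)"
    and cover: "\<And>x. x \<in> dcarrier X \<Longrightarrow> \<exists>k. 1 < f k x"
    and lam: "\<And>k. lam k \<in> L" "\<And>k x. x \<in> dcarrier X \<Longrightarrow> 1 \<le> f k x \<Longrightarrow> x \<in> U (lam k)"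
  shows "\<exists>\<psi>. partition_of_unity X L U \<psi>"
proof -
  obtain w where w: "\<And>k. dsmooth_real X (w k)" "\<And>k x. 0 \<le> w k x"
    "\<And>k x. f k x \<le> 1 \<Longrightarrow> w k x = 0"
    "\<And>x. x \<in> dcarrier X \<Longrightarrow> \<exists>k. 0 < w k x"
    "\<And>x. x \<in> dcarrier X \<Longrightarrow> \<exists>W N. D_open X W \<and> x \<in> W \<and> (\<forall>y\<in>W. \<forall>k\<ge>N. w k y = 0)"
    using locally_finite_weights[OF X f cover] by blast
  \<comment> \<open>A series gives one definition at all points, although the number of nonzero
    terms varies from point to point.\<close>
  define T where "T l x = (\<Sum>k. if lam k = l then w k x else 0)" for l x
  define S where "S x = (\<Sum>k. w k x)" for x
  define \<psi> where "\<psi> l x = T l x * inverse (S x)" for l x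
  \<comment> \<open>One bound \<open>N\<close> serves all labels on \<open>W\<close>, which later
    yields local finiteness of the supports.\<close>
  have fin: "\<exists>W N. D_open X W \<and> x \<in> W \<and> (\<forall>y\<in>W. (\<forall>k\<ge>N. w k y = 0) \<and> S y = (\<Sum>k<N. w k y) \<and>
      (\<forall>l. T l y = (\<Sum>k<N. if lam k = l then w k y else 0)))" if x: "x \<in> dcarrier X" for x
  proof -
    obtain W N where W: "D_open X W" "x \<in> W" "\<And>y k. y \<in> W \<Longrightarrow> k \<ge> N \<Longrightarrow> w k y = 0"
      using w(5)[OF x] by blast
    have "S y = (\<Sum>k<N. w k y)" if "y \<in> W" for y
      unfolding S_def by (rule suminf_finite) (use W(3)[OF that] in auto)
    moreover have "T l y = (\<Sum>k<N. if lam k = l then w k y else 0)" if "y \<in> W" for l y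
      unfolding T_def by (rule suminf_finite) (use W(3)[OF that] in auto)
    ultimately show ?thesis using W by blast
  qed
  have S: "dsmooth_real X S"
  proof (rule dsmooth_real_local[OF X])
    fix x assume "x \<in> dcarrier X"
    then obtain W N where "D_open X W" "x \<in> W" "\<And>y. y \<in> W \<Longrightarrow> S y = (\<Sum>k<N. w k y)"
      using fin by meson
    moreover have "dsmooth_real X (\<lambda>y. \<Sum>k<N. w k y)" by (intro dsmooth_real_sum w(1))
    ultimately show "\<exists>W g. D_open X W \<and> x \<in> W \<and> dsmooth_real X g \<and> (\<forall>y\<in>W. S y = g y)" by blast
  qed
  have T: "dsmooth_real X (T l)" for l
  proof (rule dsmooth_real_local[OF X])
    fix x assume "x \<in> dcarrier X"
    then obtain W N where "D_open X W" "x \<in> W"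
      "\<And>y. y \<in> W \<Longrightarrow> T l y = (\<Sum>k<N. if lam k = l then w k y else 0)"
      using fin by meson
    moreover have "dsmooth_real X (\<lambda>y. \<Sum>k<N. if lam k = l then w k y else 0)"
    proof (rule dsmooth_real_sum)
      show "dsmooth_real X (\<lambda>y. if lam k = l then w k y else 0)" for k
        by (cases "lam k = l") (simp_all add: w(1))
    qed
    ultimately show "\<exists>W g. D_open X W \<and> x \<in> W \<and> dsmooth_real X g \<and> (\<forall>y\<in>W. T l y = g y)" by blast
  qed
  have S_pos: "0 < S x" if x: "x \<in> dcarrier X" for x
  proof -
    obtain N where N: "\<And>k. k \<ge> N \<Longrightarrow> w k x = 0" "S x = (\<Sum>k<N. w k x)" using fin[OF x] by blast
    obtain k where k: "0 < w k x" using w(4)[OF x] by blast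
    then have "k < N" using N(1)[of k] by (cases "k < N") auto
    then show ?thesis unfolding N(2) by (intro sum_pos2[of _ k]) (use k w(2) in auto)
  qed
  have T_bounds: "0 \<le> T l x \<and> T l x \<le> S x" if x: "x \<in> dcarrier X" for l x
  proof -
    obtain N where "S x = (\<Sum>k<N. w k x)" "T l x = (\<Sum>k<N. if lam k = l then w k x else 0)"
      using fin[OF x] by blast
    then show ?thesis using w(2) by (auto intro!: sum_nonneg sum_mono)
  qed
  have \<psi>_nonzero: "\<exists>k<N. lam k = l \<and> w k y \<noteq> 0"
    if "\<psi> l y \<noteq> 0" "T l y = (\<Sum>k<N. if lam k = l then w k y else 0)" for l y N
  proof -
    have "T l y \<noteq> 0" using that(1) by (auto simp: \<psi>_def)
    then have "(\<Sum>k<N. if lam k = l then w k y else 0) \<noteq> 0" by (subst that(2)[symmetric])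
    then obtain k where "k \<in> {..<N}" "(if lam k = l then w k y else 0) \<noteq> 0"
      by (rule sum.not_neutral_contains_not_neutral)
    then show ?thesis by (auto split: if_splits)
  qed
  have supp_disjoint: "dsupp X (\<psi> l) \<inter> W = {}"
    if "D_open X W" "\<And>y. y \<in> W \<Longrightarrow> \<psi> l y = 0" for l W
    unfolding dsupp_def by (rule D_closure_disjoint[OF that(1)]) (use that(2) in auto)
  have "partition_of_unity X L U \<psi>"
    unfolding partition_of_unity_def
  proof (intro conjI ballI)
    fix l assume l: "l \<in> L"
    show "dsmooth_real X (\<psi> l)"
      unfolding \<psi>_def using S_pos by (intro dsmooth_real_mult dsmooth_real_inverse[OF X] S T)
    show "0 \<le> \<psi> l x" "\<psi> l x \<le> 1" if "x \<in> dcarrier X" for x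
      using T_bounds[OF that, of l] S_pos[OF that] by (auto simp: \<psi>_def field_simps)
    show "dsupp X (\<psi> l) \<subseteq> U l"
    proof (rule ccontr)
      assume "\<not> dsupp X (\<psi> l) \<subseteq> U l"
      then obtain x where x: "x \<in> dsupp X (\<psi> l)" "x \<notin> U l" by blast
      have xX: "x \<in> dcarrier X"
        using x(1) D_closure_subset_carrier[of "{x \<in> dcarrier X. \<psi> l x \<noteq> 0}" X] by (auto simp: dsupp_def)
      obtain W N where W: "D_open X W" "x \<in> W"
        "\<And>y. y \<in> W \<Longrightarrow> T l y = (\<Sum>k<N. if lam k = l then w k y else 0)"
        using fin[OF xX] by meson
      define K where "K = {k. k < N \<and> lam k = l}"
      \<comment> \<open>The strict inequalities hold at \<open>x\<close> by the contrapositive of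
        the assumption on \<open>lam\<close>, and finiteness of \<open>K\<close> keeps the
        intersection D-open.\<close>
      define W' where "W' = W \<inter> (\<Inter>k\<in>K. {y \<in> dcarrier X. f k y \<in> {..<1}})"
      have "D_open X W'"
        unfolding W'_def by (intro D_open_Int_INT W(1) D_open_vimage[OF X f]) (auto simp: K_def)
      moreover have "\<psi> l y = 0" if y: "y \<in> W'" for y
      proof (rule ccontr)
        assume "\<psi> l y \<noteq> 0"
        then obtain k where "k \<in> K" "w k y \<noteq> 0"
          using \<psi>_nonzero[OF _ W(3)] y by (auto simp: W'_def K_def)
        then show False using w(3)[of k y] y by (auto simp: W'_def)
      qed
      ultimately have "dsupp X (\<psi> l) \<inter> W' = {}" by (rule supp_disjoint)
      moreover have "x \<in> W'"
        using W(2) xX x(2) lam(2)[OF xX] by (force simp: W'_def K_def)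
      ultimately show False using x(1) by blast
    qed
  next
    show "D_locally_finite X L (\<lambda>l. dsupp X (\<psi> l))"
      unfolding D_locally_finite_def
    proof
      fix x assume "x \<in> dcarrier X"
      then obtain W N where W: "D_open X W" "x \<in> W"
        "\<And>y l. y \<in> W \<Longrightarrow> T l y = (\<Sum>k<N. if lam k = l then w k y else 0)"
        using fin by meson
      have "l \<in> lam ` {..<N}" if "dsupp X (\<psi> l) \<inter> W \<noteq> {}" for l
        using supp_disjoint[OF W(1), of l] that \<psi>_nonzero[OF _ W(3)] by blast
      then have "{l \<in> L. dsupp X (\<psi> l) \<inter> W \<noteq> {}} \<subseteq> lam ` {..<N}" by blast
      then have "finite {l \<in> L. dsupp X (\<psi> l) \<inter> W \<noteq> {}}" by (rule finite_subset) simp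
      then show "\<exists>W. D_open X W \<and> x \<in> W \<and> finite {l \<in> L. dsupp X (\<psi> l) \<inter> W \<noteq> {}}"
        using W(1,2) by blast
    qed
  next
    fix x assume x: "x \<in> dcarrier X"
    then obtain N where N: "S x = (\<Sum>k<N. w k x)"
      "\<And>l. T l x = (\<Sum>k<N. if lam k = l then w k x else 0)"
      using fin by blast
    have "(\<Sum>l\<in>{l \<in> L. \<psi> l x \<noteq> 0}. \<psi> l x) = (\<Sum>l\<in>lam ` {..<N}. \<psi> l x)"
      using \<psi>_nonzero[OF _ N(2)] lam(1) by (intro sum.mono_neutral_left) auto
    also have "\<dots> = (\<Sum>l\<in>lam ` {..<N}. \<Sum>k<N. if lam k = l then w k x else 0) * inverse (S x)"
      by (simp add: \<psi>_def N(2) sum_distrib_right)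
    \<comment> \<open>After exchanging the sums, each index \<open>k < N\<close> is counted once,
      under its own label.\<close>
    also have "(\<Sum>l\<in>lam ` {..<N}. \<Sum>k<N. if lam k = l then w k x else 0) = S x"
      unfolding N(1) by (subst sum.swap) (simp add: sum.delta)
    also have "S x * inverse (S x) = 1" using S_pos[OF x] by simp
    finally show "(\<Sum>l\<in>{l \<in> L. \<psi> l x \<noteq> 0}. \<psi> l x) = 1" .
  qed
  then show ?thesis by blast
qed

section \<open>Existence of partitions of unity on cell complexes\<close>

text \<open>The empty space is treated apart because enumerating the chosen points presupposes that
  there is one.\<close>

lemma partition_of_unity_empty:
  assumes "dcarrier X = {}"
  shows "partition_of_unity X L U (\<lambda>_ _. 0)"
  using assms D_closure_subset_carrier[of "{}" X]
  by (auto simp: partition_of_unity_def D_locally_finite_def dsupp_def)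

theorem theorem6:
  fixes X :: "'x diffsp" and Z :: "'i::wellorder \<Rightarrow> 'a diffsp" and Zm :: "'i \<Rightarrow> 'i \<Rightarrow> 'a \<Rightarrow> 'a"
    and L :: "'l set" and U :: "'l \<Rightarrow> 'x set"
  assumes "countable (UNIV :: 'i set)"
    and "smooth_cell_complex X Z Zm"
    and "D_open_cover X L U"
  shows "\<exists>\<psi>. partition_of_unity X L U \<psi>"
proof (cases "dcarrier X = {}")
  case True
  then show ?thesis using partition_of_unity_empty by blast
next
  case False
  obtain inc where "cell_complex X Z Zm inc"
    using assms(2) unfolding smooth_cell_complex_def cell_complex_def by blast
  then interpret cell_complex X Z Zm inc .
  have "\<exists>l h. l \<in> L \<and> dsmooth_real X h \<and> (\<forall>y\<in>dcarrier X. y \<notin> U l \<longrightarrow> h y < 1) \<and> h x = 2"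
    if "x \<in> dcarrier X" for x
  proof -
    obtain l where "l \<in> L" "D_open X (U l)" "x \<in> U l"
      using assms(3) \<open>x \<in> dcarrier X\<close> unfolding D_open_cover_def by blast
    then show ?thesis using separating_function by metis
  qed
  then obtain lam h where lam: "\<And>x. x \<in> dcarrier X \<Longrightarrow> lam x \<in> L"
    and h: "\<And>x. x \<in> dcarrier X \<Longrightarrow> dsmooth_real X (h x)"
      "\<And>x y. x \<in> dcarrier X \<Longrightarrow> y \<in> dcarrier X \<Longrightarrow> y \<notin> U (lam x) \<Longrightarrow> h x y < 1"
      "\<And>x. x \<in> dcarrier X \<Longrightarrow> h x x = 2"
    by metis
  \<comment> \<open>The value 2 puts \<open>x\<close> into \<open>W x\<close>, so these sets cover;
    a countable subcover supplies the sequence of functions exceeding 1 somewhere at each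
    point.\<close>
  define W where "W x = {y \<in> dcarrier X. h x y \<in> {1<..}}" for x
  have W: "D_open X (W x)" if "x \<in> dcarrier X" for x
    unfolding W_def by (rule D_open_vimage[OF diffeology_X h(1)[OF that]]) simp
  have W_self: "x \<in> W x" if "x \<in> dcarrier X" for x using h(3) that by (simp add: W_def)
  obtain C where C: "countable C" "C \<subseteq> dcarrier X" "dcarrier X \<subseteq> (\<Union>x\<in>C. W x)"
    by (rule countable_subcover[OF assms(1) W W_self])
  then have "C \<noteq> {}" using False by auto
  \<comment> \<open>The enumeration may repeat points, which includes the case of finite
    \<open>C\<close>; repeated indices share a label and their weights are added.\<close>
  let ?c = "from_nat_into C"
  have range_c: "range ?c = C" using \<open>C \<noteq> {}\<close> C(1) by (rule range_from_nat_into)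
  have c: "?c k \<in> dcarrier X" for k using range_c C(2) by auto
  show ?thesis
  proof (rule partition_of_unity_if_separating_sequence[where f = "\<lambda>k. h (?c k)" and lam = "\<lambda>k. lam (?c k)", OF diffeology_X])
    show "\<exists>k. 1 < h (?c k) x" if x: "x \<in> dcarrier X" for x
    proof -
      obtain y where "y \<in> C" "x \<in> W y" using C(3) x by blast
      moreover from this obtain k where "y = ?c k" using range_c by blast
      ultimately show ?thesis by (auto simp: W_def)
    qed
    show "x \<in> U (lam (?c k))" if "x \<in> dcarrier X" "1 \<le> h (?c k) x" for x k
      using h(2)[OF c that(1)] that(2) by force
  qed (use h(1) c lam in auto)
qed

end
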